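(* Let $\varepsilon\in\{1,-1\}$, let $f(x,y)=-\varepsilon x^2$, and let $(M,g_f)$ be the homogeneous three-dimensional Lorentzian strictly Walker manifold of type $\mathcal{CW}_\varepsilon$, with coordinates $(t,x,y)$ and metric $g_f=2\,dt\,dy+dx^2+f(x,y)\,dy^2$. For real constants $c_1,c_2$ consider the functions $$S(y)=\begin{cases}c_2\sin(y)-c_1\cos(y)&\text{if }\varepsilon=1,\\ c_1e^{-y}-c_2e^{y}&\text{if }\varepsilon=-1,\end{cases}\qquad T(y)=\begin{cases}c_1\sin(y)+c_2\cos(y)&\text{if }\varepsilon=1,\\ c_1e^{-y}+c_2e^{y}&\text{if }\varepsilon=-1.\end{cases}$$ Then an arbitrary smooth vector field $X=X_1\partial_t+X_2\partial_x+X_3\partial_y$ on $M$: - is Killing if and only if $$X_1=S(y)x+c_3,\qquad X_2=T(y),\qquad X_3=c_4$$ for some real constants $c_1,\dots,c_4$; - is homothetic if and only if $$X_1=S(y)x+c_3+\eta t,\qquad X_2=T(y)+\frac{\eta}{2}x,\qquad X_3=c_4$$ for some real constants $c_1,\dots,c_4,\eta$; - is affine if and only if $$X_1=S(y)x+c_3+c_5t+c_6y,\qquad X_2=T(y)+\frac{c_5}{2}x,\qquad X_3=c_4$$ for some real constants $c_1,\dots,c_6$; - is a Ricci collineation if and only if $X_3=c_1$ for some real constant $c_1$; - is a curvature collineation if and only if $$X_1=2f_1(y)t-\frac12f_1'(y)x^2-f_2'(y)x+f_3(y),\qquad X_2=f_1(y)x+f_2(y),\qquad X_3=c_1$$ for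 some smooth functions $f_1,f_2,f_3$ of $y$ and some real constant $c_1$.
   Context: The statement is local: the coordinates $(t,x,y)$ range over a product of open intervals. In the coordinate frame, $g_f(\partial_t,\partial_y)=1$, $g_f(\partial_x,\partial_x)=1$, $g_f(\partial_y,\partial_y)=f(x,y)$, and all other components vanish. Let $\mathcal L$ denote the Lie derivative, $\nabla$ the Levi-Civita connection, $R$ the curvature tensor (as a $(1,3)$-tensor) and $\varrho$ the Ricci tensor of $g_f$. A vector field $X$ is Killing if $\mathcal L_Xg_f=0$; homothetic if $\mathcal L_Xg_f=\eta g_f$ for some real constant $\eta$; affine if $\mathcal L_X\nabla=0$; a Ricci collineation if $\mathcal L_X\varrho=0$; a curvature collineation if $\mathcal L_XR=0$. Components of $X$ on which no condition is listed are unrestricted smooth functions of $(t,x,y)$. *)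

theory Defs
  imports "HOL-Analysis.Analysis"
begin

primrec Ck_on :: "nat \<Rightarrow> 'a::real_normed_vector set \<Rightarrow> ('a \<Rightarrow> 'b::real_normed_vector) \<Rightarrow> bool" where
  "Ck_on 0 S f \<longleftrightarrow> continuous_on S f"
| "Ck_on (Suc k) S f \<longleftrightarrow>
     (\<forall>p\<in>S. f differentiable (at p)) \<and>
     (\<forall>v. Ck_on k S (\<lambda>p. frechet_derivative f (at p) v))"

text \<open>Meant for open \<open>S\<close> in a finite-dimensional space, where this is the usual class
  of infinitely differentiable maps. Values outside \<open>S\<close> are irrelevant.\<close>

definition smooth_on :: "'a::real_normed_vector set \<Rightarrow> ('a \<Rightarrow> 'b::real_normed_vector) \<Rightarrow> bool" where
  "smooth_on S f \<longleftrightarrow> (\<forall>k. Ck_on k S f)"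

text \<open>The chart domain is an open subset \<open>M\<close> of \<open>real ^ 'n\<close>. A vector field is given by its
  components in the coordinate frame, a metric by its Gram matrix in that frame. Tensor fields
  and connections are represented as operations on vector fields.\<close>

type_synonym 'n vfield = "real ^ 'n \<Rightarrow> real ^ 'n"
type_synonym 'n metric = "real ^ 'n \<Rightarrow> real ^ 'n ^ 'n"

definition coord_field :: "'n \<Rightarrow> 'n::finite vfield" where
  "coord_field i = (\<lambda>p. axis i 1)"

text \<open>The derivative \<open>X(h)\<close> of a (scalar or vector-valued) function, componentwise.\<close>

definition dir_deriv :: "'n::finite vfield \<Rightarrow> (real ^ 'n \<Rightarrow> 'b::real_normed_vector) \<Rightarrow> real ^ 'n \<Rightarrow> 'b" where
  "dir_deriv X h = (\<lambda>p. frechet_derivative h (at p) (X p))"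

definition lie_bracket :: "'n::finite vfield \<Rightarrow> 'n vfield \<Rightarrow> 'n vfield" where
  "lie_bracket X Y = (\<lambda>p. dir_deriv X Y p - dir_deriv Y X p)"

definition metric_tensor :: "'n::finite metric \<Rightarrow> 'n vfield \<Rightarrow> 'n vfield \<Rightarrow> real ^ 'n \<Rightarrow> real" where
  "metric_tensor g Y Z = (\<lambda>p. Y p \<bullet> (g p *v Z p))"

text \<open>\<open>christoffel g k i j\<close> has upper index \<open>k\<close> and lower indices \<open>i\<close>, \<open>j\<close>.\<close>

definition christoffel :: "'n::finite metric \<Rightarrow> 'n \<Rightarrow> 'n \<Rightarrow> 'n \<Rightarrow> real ^ 'n \<Rightarrow> real" where
  "christoffel g k i j = (\<lambda>p. 1 / 2 * (\<Sum>l\<in>UNIV. matrix_inv (g p) $ k $ l *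
     (dir_deriv (coord_field i) (\<lambda>q. g q $ j $ l) p
      + dir_deriv (coord_field j) (\<lambda>q. g q $ i $ l) p
      - dir_deriv (coord_field l) (\<lambda>q. g q $ i $ j) p)))"

definition levi_civita :: "'n::finite metric \<Rightarrow> 'n vfield \<Rightarrow> 'n vfield \<Rightarrow> 'n vfield" where
  "levi_civita g Y Z = (\<lambda>p. dir_deriv Y Z p +
     (\<chi> k. \<Sum>i\<in>UNIV. \<Sum>j\<in>UNIV. christoffel g k i j p * Y p $ i * Z p $ j))"

definition curvature :: "'n::finite metric \<Rightarrow> 'n vfield \<Rightarrow> 'n vfield \<Rightarrow> 'n vfield \<Rightarrow> 'n vfield" where
  "curvature g Y Z W = (\<lambda>p.
     levi_civita g Y (levi_civita g Z W) p
     - levi_civita g Z (levi_civita g Y W) p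
     - levi_civita g (lie_bracket Y Z) W p)"

text \<open>The Ricci tensor at \<open>(Y, Z)\<close> is the trace of \<open>U \<mapsto> R(U, Y) Z\<close>.\<close>

definition ricci :: "'n::finite metric \<Rightarrow> 'n vfield \<Rightarrow> 'n vfield \<Rightarrow> real ^ 'n \<Rightarrow> real" where
  "ricci g Y Z = (\<lambda>p. \<Sum>i\<in>UNIV. curvature g (coord_field i) Y Z p $ i)"

definition lie_bilinear ::
  "'n::finite vfield \<Rightarrow> ('n vfield \<Rightarrow> 'n vfield \<Rightarrow> real ^ 'n \<Rightarrow> real)
    \<Rightarrow> 'n vfield \<Rightarrow> 'n vfield \<Rightarrow> real ^ 'n \<Rightarrow> real" where
  "lie_bilinear X B Y Z = (\<lambda>p.
     dir_deriv X (B Y Z) p - B (lie_bracket X Y) Z p - B Y (lie_bracket X Z) p)"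

definition lie_connection ::
  "'n::finite vfield \<Rightarrow> ('n vfield \<Rightarrow> 'n vfield \<Rightarrow> 'n vfield)
    \<Rightarrow> 'n vfield \<Rightarrow> 'n vfield \<Rightarrow> 'n vfield" where
  "lie_connection X D Y Z = (\<lambda>p.
     lie_bracket X (D Y Z) p - D (lie_bracket X Y) Z p - D Y (lie_bracket X Z) p)"

definition lie_trilinear ::
  "'n::finite vfield \<Rightarrow> ('n vfield \<Rightarrow> 'n vfield \<Rightarrow> 'n vfield \<Rightarrow> 'n vfield)
    \<Rightarrow> 'n vfield \<Rightarrow> 'n vfield \<Rightarrow> 'n vfield \<Rightarrow> 'n vfield" where
  "lie_trilinear X R Y Z W = (\<lambda>p.
     lie_bracket X (R Y Z W) p - R (lie_bracket X Y) Z W p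
     - R Y (lie_bracket X Z) W p - R Y Z (lie_bracket X W) p)"

definition killing_field :: "(real ^ 'n::finite) set \<Rightarrow> 'n metric \<Rightarrow> 'n vfield \<Rightarrow> bool" where
  "killing_field M g X \<longleftrightarrow>
     (\<forall>Y Z. smooth_on M Y \<longrightarrow> smooth_on M Z \<longrightarrow>
        (\<forall>p\<in>M. lie_bilinear X (metric_tensor g) Y Z p = 0))"

definition homothetic_field :: "(real ^ 'n::finite) set \<Rightarrow> 'n metric \<Rightarrow> 'n vfield \<Rightarrow> bool" where
  "homothetic_field M g X \<longleftrightarrow>
     (\<exists>\<eta>. \<forall>Y Z. smooth_on M Y \<longrightarrow> smooth_on M Z \<longrightarrow>
        (\<forall>p\<in>M. lie_bilinear X (metric_tensor g) Y Z p = \<eta> * metric_tensor g Y Z p))"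

definition affine_field :: "(real ^ 'n::finite) set \<Rightarrow> 'n metric \<Rightarrow> 'n vfield \<Rightarrow> bool" where
  "affine_field M g X \<longleftrightarrow>
     (\<forall>Y Z. smooth_on M Y \<longrightarrow> smooth_on M Z \<longrightarrow>
        (\<forall>p\<in>M. lie_connection X (levi_civita g) Y Z p = 0))"

definition ricci_collineation :: "(real ^ 'n::finite) set \<Rightarrow> 'n metric \<Rightarrow> 'n vfield \<Rightarrow> bool" where
  "ricci_collineation M g X \<longleftrightarrow>
     (\<forall>Y Z. smooth_on M Y \<longrightarrow> smooth_on M Z \<longrightarrow>
        (\<forall>p\<in>M. lie_bilinear X (ricci g) Y Z p = 0))"

definition curvature_collineation :: "(real ^ 'n::finite) set \<Rightarrow> 'n metric \<Rightarrow> 'n vfield \<Rightarrow> bool" where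
  "curvature_collineation M g X \<longleftrightarrow>
     (\<forall>Y Z W. smooth_on M Y \<longrightarrow> smooth_on M Z \<longrightarrow> smooth_on M W \<longrightarrow>
        (\<forall>p\<in>M. lie_trilinear X (curvature g) Y Z W p = 0))"

text \<open>Coordinates \<open>(t, x, y)\<close> are the components with index \<open>1\<close>, \<open>2\<close>, \<open>3\<close> of a point of
  \<open>real ^ 3\<close>.\<close>

definition coord_box :: "real set \<Rightarrow> real set \<Rightarrow> real set \<Rightarrow> (real ^ 3) set" where
  "coord_box I J K = {p. p $ 1 \<in> I \<and> p $ 2 \<in> J \<and> p $ 3 \<in> K}"

definition walker_metric :: "(real \<Rightarrow> real \<Rightarrow> real) \<Rightarrow> 3 metric" where
  "walker_metric f = (\<lambda>p. vector [
     vector [0, 0, 1],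
     vector [0, 1, 0],
     vector [1, 0, f (p $ 2) (p $ 3)]])"

definition cw_metric :: "real \<Rightarrow> 3 metric" where
  "cw_metric \<epsilon> = walker_metric (\<lambda>x y. - \<epsilon> * x\<^sup>2)"

text \<open>Only \<open>\<epsilon> = 1\<close> and \<open>\<epsilon> = -1\<close> matter below.\<close>

definition cw_S :: "real \<Rightarrow> real \<Rightarrow> real \<Rightarrow> real \<Rightarrow> real" where
  "cw_S \<epsilon> c1 c2 y =
     (if \<epsilon> = 1 then c2 * sin y - c1 * cos y else c1 * exp (- y) - c2 * exp y)"

definition cw_T :: "real \<Rightarrow> real \<Rightarrow> real \<Rightarrow> real \<Rightarrow> real" where
  "cw_T \<epsilon> c1 c2 y =
     (if \<epsilon> = 1 then c1 * sin y + c2 * cos y else c1 * exp (- y) + c2 * exp y)"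

end

theory Submission
  imports Defs
begin

text \<open>
The Christoffel part of the Levi-Civita connection is trilinear in (base point, two vectors), and the
curvature is \<open>R(Y,Z)W = \<epsilon> (dx \<and> dy)(Y,Z) (dy(W) \<partial>\<^sub>x - dx(W) \<partial>\<^sub>t)\<close>, with constant coefficients;
the Ricci tensor is \<open>\<epsilon> dy\<^sup>2\<close>. Each Lie derivative then depends only on the values of its vector
arguments, so each condition on \<open>X\<close> is a linear system of partial differential equations.
The homothetic and the affine equations overdetermine \<open>X\<close>: differentiating them in \<open>x\<close> and commuting
derivatives shows that \<open>X\<^sub>3\<close> and \<open>\<partial>\<^sub>x X\<^sub>2\<close> are constant, \<open>\<partial>\<^sub>t X\<^sub>2 = 0\<close>, \<open>\<partial>\<^sub>t X\<^sub>1 = 2 \<partial>\<^sub>x X\<^sub>2\<close>,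
\<open>\<partial>\<^sub>x X\<^sub>1 = - \<partial>\<^sub>y X\<^sub>2\<close>, and that \<open>T = X\<^sub>2 - x \<partial>\<^sub>x X\<^sub>2\<close> solves the oscillator equation \<open>T'' = - \<epsilon> T\<close>.
All integrations reduce to one principle: a smooth function on a convex domain
whose partial derivatives vanish is constant.
\<close>

section \<open>Smooth maps and second derivatives\<close>

text \<open>The conditions on X quantify over arbitrary smooth vector fields, and derivatives of
  these fields enter every Lie derivative. They cancel by tensoriality; for the curvature and the
  connection the cancellation rests on equality of mixed second derivatives, which is therefore
  derived from the recursive notion of smoothness. Constant fields then recover the pointwise
  identities. The coefficients of these identities contain the factor x, and the domain may meet the
  plane x = 0. Division by x is thus excluded; differentiation in x removes the factor instead and
  exposes a bare first derivative of X. A homothety preserves the Levi-Civita connection, so the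
  homothetic equations lead to the same solved system as the affine ones and only fix two of its
  constants. The curvature has constant coefficients, so curvature collineations obey first-order
  equations only, none of which contains d_y X1; this is why functions of y remain free
  there.\<close>

lemma Ck_on_cong:
  assumes "open S" "\<And>p. p \<in> S \<Longrightarrow> f p = g p" "Ck_on k S f"
  shows "Ck_on k S g"
  using assms(2,3)
proof (induction k arbitrary: f g)
  case 0
  then show ?case
    using continuous_on_cong[of S S f g] by simp
next
  case (Suc k)
  have eq: "frechet_derivative f (at p) = frechet_derivative g (at p)" if "p \<in> S" for p
    using Suc.prems that \<open>open S\<close>
    by (intro frechet_derivative_transform_within_open[of f p S g]) auto
  have "g differentiable (at p)" if "p \<in> S" for p
  proof -
    have "(f has_derivative frechet_derivative f (at p)) (at p)"
      using Suc.prems that frechet_derivative_works by auto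
    then have "(g has_derivative frechet_derivative f (at p)) (at p)"
      using has_derivative_transform_within_open \<open>open S\<close> that Suc.prems(1) by blast
    then show ?thesis
      by (rule differentiableI)
  qed
  moreover have "Ck_on k S (\<lambda>p. frechet_derivative g (at p) v)" for v
    using Suc.IH[of "\<lambda>p. frechet_derivative f (at p) v"] Suc.prems eq by auto
  ultimately show ?case
    by simp
qed

lemma Ck_on_SucD: "Ck_on (Suc k) S f \<Longrightarrow> Ck_on k S f"
proof (induction k arbitrary: f)
  case 0
  then show ?case
    by (auto intro!: continuous_at_imp_continuous_on differentiable_imp_continuous_within)
qed auto

section \<open>Closure of \<open>C^k\<close> maps under linear and bilinear operations\<close>

lemma Ck_on_linear:
  assumes "bounded_linear L" "open S" "Ck_on k S f"
  shows "Ck_on k S (\<lambda>p. L (f p))"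
  using assms(3)
proof (induction k arbitrary: f)
  case 0
  then show ?case
    using bounded_linear.continuous_on[OF assms(1)] by auto
next
  case (Suc k)
  have der: "((\<lambda>p. L (f p)) has_derivative (\<lambda>v. L (frechet_derivative f (at p) v))) (at p)"
    if "p \<in> S" for p
    using Suc.prems that by (intro bounded_linear.has_derivative[OF assms(1)]) (auto simp: frechet_derivative_works)
  have "Ck_on k S (\<lambda>p. L (frechet_derivative f (at p) v))" for v
    using Suc by auto
  then have "Ck_on k S (\<lambda>p. frechet_derivative (\<lambda>p. L (f p)) (at p) v)" for v
    by (rule Ck_on_cong[OF \<open>open S\<close>, rotated]) (simp add: frechet_derivative_at[OF der, symmetric])
  with der show ?case
    by (auto intro: differentiableI)
qed

lemma Ck_on_add:
  assumes "open S" "Ck_on k S f" "Ck_on k S g"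
  shows "Ck_on k S (\<lambda>p. f p + g p)"
  using assms(2,3)
proof (induction k arbitrary: f g)
  case 0
  then show ?case
    by (auto intro: continuous_intros)
next
  case (Suc k)
  have der: "((\<lambda>p. f p + g p) has_derivative
      (\<lambda>v. frechet_derivative f (at p) v + frechet_derivative g (at p) v)) (at p)"
    if "p \<in> S" for p
    using Suc.prems that by (intro has_derivative_add) (auto simp: frechet_derivative_works)
  have "Ck_on k S (\<lambda>p. frechet_derivative f (at p) v + frechet_derivative g (at p) v)" for v
    using Suc by auto
  then have "Ck_on k S (\<lambda>p. frechet_derivative (\<lambda>p. f p + g p) (at p) v)" for v
    by (rule Ck_on_cong[OF \<open>open S\<close>, rotated]) (simp add: frechet_derivative_at[OF der, symmetric])
  with der show ?case
    by (auto intro: differentiableI)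
qed

text \<open>The product rule leaves one factor undifferentiated in each term, so the induction needs
  \<open>Ck_on_SucD\<close> to lower the order of that factor.\<close>

lemma Ck_on_bilinear:
  assumes "bounded_bilinear B" "open S" "Ck_on k S f" "Ck_on k S g"
  shows "Ck_on k S (\<lambda>p. B (f p) (g p))"
  using assms(3,4)
proof (induction k arbitrary: f g)
  case 0
  then show ?case
    using bounded_bilinear.continuous_on[OF assms(1)] by auto
next
  case (Suc k)
  have der: "((\<lambda>p. B (f p) (g p)) has_derivative
      (\<lambda>v. B (f p) (frechet_derivative g (at p) v) + B (frechet_derivative f (at p) v) (g p))) (at p)"
    if "p \<in> S" for p
    using Suc.prems that by (intro bounded_bilinear.FDERIV[OF assms(1)]) (auto simp: frechet_derivative_works)
  have "Ck_on k S (\<lambda>p. B (f p) (frechet_derivative g (at p) v) + B (frechet_derivative f (at p) v) (g p))"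
    for v
    using Suc Ck_on_SucD[OF Suc.prems(1)] Ck_on_SucD[OF Suc.prems(2)]
    by (intro Ck_on_add \<open>open S\<close>) auto
  then have "Ck_on k S (\<lambda>p. frechet_derivative (\<lambda>p. B (f p) (g p)) (at p) v)" for v
    by (rule Ck_on_cong[OF \<open>open S\<close>, rotated]) (simp add: frechet_derivative_at[OF der, symmetric])
  with der show ?case
    by (auto intro: differentiableI)
qed

lemma Ck_on_const: "Ck_on k S (\<lambda>p. c)"
  by (induction k arbitrary: c) auto

lemma Ck_on_ident: "Ck_on k S (\<lambda>p. p)"
  by (cases k) (auto simp: Ck_on_const)

lemma smooth_on_cong:
  assumes "open S" "\<And>p. p \<in> S \<Longrightarrow> f p = g p" "smooth_on S f"
  shows "smooth_on S g"
  using assms Ck_on_cong unfolding smooth_on_def by blast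

lemma smooth_on_const: "smooth_on S (\<lambda>p. c)"
  by (simp add: smooth_on_def Ck_on_const)

lemma smooth_on_ident: "smooth_on S (\<lambda>p. p)"
  by (simp add: smooth_on_def Ck_on_ident)

lemma smooth_on_linear: "bounded_linear L \<Longrightarrow> open S \<Longrightarrow> smooth_on S f \<Longrightarrow> smooth_on S (\<lambda>p. L (f p))"
  by (simp add: smooth_on_def Ck_on_linear)

lemmas smooth_on_vec_nth = smooth_on_linear[OF bounded_linear_vec_nth]

lemma smooth_on_add: "open S \<Longrightarrow> smooth_on S f \<Longrightarrow> smooth_on S g \<Longrightarrow> smooth_on S (\<lambda>p. f p + g p)"
  by (simp add: smooth_on_def Ck_on_add)

lemma smooth_on_minus: "open S \<Longrightarrow> smooth_on S f \<Longrightarrow> smooth_on S (\<lambda>p. - f p)"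
  by (rule smooth_on_linear[OF bounded_linear_minus[OF bounded_linear_ident]])

lemma smooth_on_diff: "open S \<Longrightarrow> smooth_on S f \<Longrightarrow> smooth_on S g \<Longrightarrow> smooth_on S (\<lambda>p. f p - g p)"
  using smooth_on_add[of S f "\<lambda>p. - g p"] smooth_on_minus[of S g] by simp

lemma smooth_on_bilinear:
  "bounded_bilinear B \<Longrightarrow> open S \<Longrightarrow> smooth_on S f \<Longrightarrow> smooth_on S g \<Longrightarrow> smooth_on S (\<lambda>p. B (f p) (g p))"
  by (simp add: smooth_on_def Ck_on_bilinear)

lemmas smooth_on_mult = smooth_on_bilinear[OF bounded_bilinear_mult]
lemmas smooth_on_scaleR = smooth_on_bilinear[OF bounded_bilinear_scaleR]

lemma smooth_on_power:
  fixes f :: "'a::real_normed_vector \<Rightarrow> real"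
  shows "open S \<Longrightarrow> smooth_on S f \<Longrightarrow> smooth_on S (\<lambda>p. f p ^ n)"
  by (induction n) (auto intro: smooth_on_mult smooth_on_const)

lemma smooth_on_sum:
  "open S \<Longrightarrow> (\<And>i. i \<in> A \<Longrightarrow> smooth_on S (f i)) \<Longrightarrow> smooth_on S (\<lambda>p. \<Sum>i\<in>A. f i p)"
  by (induction A rule: infinite_finite_induct) (auto intro: smooth_on_add smooth_on_const)

lemma smooth_on_frechet_derivative:
  "smooth_on S f \<Longrightarrow> smooth_on S (\<lambda>p. frechet_derivative f (at p) v)"
  unfolding smooth_on_def using Ck_on.simps(2) by blast

lemma smooth_on_has_derivative:
  "smooth_on S f \<Longrightarrow> p \<in> S \<Longrightarrow> (f has_derivative frechet_derivative f (at p)) (at p)"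
  unfolding smooth_on_def using Ck_on.simps(2) frechet_derivative_works by blast

lemma smooth_on_continuous_on: "smooth_on S f \<Longrightarrow> continuous_on S f"
  unfolding smooth_on_def using Ck_on.simps(1) by blast

text \<open>\<open>Ck_on\<close> controls derivatives along fixed vectors only. The expansion turns
  a derivative along a moving direction \<open>Z p\<close> into a sum of products of smooth
  functions, which can be differentiated again.\<close>

lemma frechet_derivative_basis_expansion:
  fixes f :: "'a::euclidean_space \<Rightarrow> 'b::real_normed_vector"
  assumes "smooth_on S f" "p \<in> S"
  shows "frechet_derivative f (at p) v = (\<Sum>b\<in>Basis. (v \<bullet> b) *\<^sub>R frechet_derivative f (at p) b)"
proof -
  have lin: "linear (frechet_derivative f (at p))"
    using smooth_on_has_derivative[OF assms] by (simp add: has_derivative_linear)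
  have "frechet_derivative f (at p) v = frechet_derivative f (at p) (\<Sum>b\<in>Basis. (v \<bullet> b) *\<^sub>R b)"
    by (simp add: euclidean_representation)
  also have "\<dots> = (\<Sum>b\<in>Basis. (v \<bullet> b) *\<^sub>R frechet_derivative f (at p) b)"
    by (simp add: linear_sum[OF lin] linear_scale[OF lin])
  finally show ?thesis .
qed

lemma smooth_on_directional_derivative:
  fixes f :: "'a::euclidean_space \<Rightarrow> 'b::real_normed_vector"
  assumes "open S" "smooth_on S f" "smooth_on S Z"
  shows "smooth_on S (\<lambda>p. frechet_derivative f (at p) (Z p))"
proof (rule smooth_on_cong[OF \<open>open S\<close>])
  show "smooth_on S (\<lambda>p. \<Sum>b\<in>Basis. (Z p \<bullet> b) *\<^sub>R frechet_derivative f (at p) b)"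
    using assms
    by (auto intro!: smooth_on_sum smooth_on_scaleR smooth_on_frechet_derivative
        smooth_on_linear[OF bounded_linear_inner_left])
qed (rule frechet_derivative_basis_expansion[OF assms(2), symmetric])

section \<open>Equality of mixed second derivatives\<close>

lemma has_real_derivative_along_line:
  fixes f :: "'a::real_normed_vector \<Rightarrow> real"
  assumes "smooth_on S f" "q + \<tau> *\<^sub>R u \<in> S"
  shows "((\<lambda>\<tau>. f (q + \<tau> *\<^sub>R u)) has_real_derivative frechet_derivative f (at (q + \<tau> *\<^sub>R u)) u) (at \<tau>)"
proof -
  have f: "(f has_derivative frechet_derivative f (at (q + \<tau> *\<^sub>R u))) (at (q + \<tau> *\<^sub>R u))"
    by (rule smooth_on_has_derivative[OF assms])
  have "((\<lambda>\<tau>. f (q + \<tau> *\<^sub>R u)) has_derivative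
      (\<lambda>h. frechet_derivative f (at (q + \<tau> *\<^sub>R u)) (h *\<^sub>R u))) (at \<tau>)"
    by (rule has_derivative_compose[where g = f and f = "\<lambda>\<tau>. q + \<tau> *\<^sub>R u", OF _ f])
      (auto intro!: derivative_eq_intros)
  then show ?thesis
    using linear_scale[OF has_derivative_linear[OF f]]
    by (simp add: has_field_derivative_def mult.commute mult_commute_abs)
qed

text \<open>The mean value theorem is used twice: in direction \<open>u\<close> on the difference of
  two translates of \<open>f\<close>, then in direction \<open>v\<close> on the resulting
  derivative. The second difference is symmetric in \<open>u\<close> and \<open>v\<close>, the
  expression found for it is not.\<close>

lemma second_difference_mvt:
  fixes f :: "'a::real_normed_vector \<Rightarrow> real"
  assumes f: "smooth_on S f" and "s > 0"
    and S: "\<And>\<tau> \<sigma>. \<tau> \<in> {0..s} \<Longrightarrow> \<sigma> \<in> {0..s} \<Longrightarrow> p + \<tau> *\<^sub>R u + \<sigma> *\<^sub>R v \<in> S"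
  shows "\<exists>\<tau>\<in>{0..s}. \<exists>\<sigma>\<in>{0..s}.
    f (p + s *\<^sub>R u + s *\<^sub>R v) - f (p + s *\<^sub>R u) - f (p + s *\<^sub>R v) + f p =
    s * s * frechet_derivative (\<lambda>q. frechet_derivative f (at q) u) (at (p + \<tau> *\<^sub>R u + \<sigma> *\<^sub>R v)) v"
proof -
  let ?G = "\<lambda>\<tau>. f ((p + s *\<^sub>R v) + \<tau> *\<^sub>R u) - f (p + \<tau> *\<^sub>R u)"
  let ?D = "\<lambda>q. frechet_derivative f (at q) u"
  have G: "(?G has_real_derivative ?D ((p + s *\<^sub>R v) + \<tau> *\<^sub>R u) - ?D (p + \<tau> *\<^sub>R u)) (at \<tau>)"
    if "0 \<le> \<tau>" "\<tau> \<le> s" for \<tau>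
    using S[of \<tau> s] S[of \<tau> 0] that
    by (intro DERIV_diff has_real_derivative_along_line[OF f]) (auto simp: algebra_simps)
  obtain \<tau> where \<tau>: "0 < \<tau>" "\<tau> < s"
      "?G s - ?G 0 = (s - 0) * (?D ((p + s *\<^sub>R v) + \<tau> *\<^sub>R u) - ?D (p + \<tau> *\<^sub>R u))"
    using MVT2[OF \<open>s > 0\<close> G] by blast
  have H: "((\<lambda>\<sigma>. ?D ((p + \<tau> *\<^sub>R u) + \<sigma> *\<^sub>R v)) has_real_derivative
      frechet_derivative ?D (at ((p + \<tau> *\<^sub>R u) + \<sigma> *\<^sub>R v)) v) (at \<sigma>)"
    if "0 \<le> \<sigma>" "\<sigma> \<le> s" for \<sigma>
    using S[of \<tau> \<sigma>] that \<tau>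
    by (intro has_real_derivative_along_line[OF smooth_on_frechet_derivative[OF f]]) auto
  obtain \<sigma> where \<sigma>: "0 < \<sigma>" "\<sigma> < s"
      "?D ((p + \<tau> *\<^sub>R u) + s *\<^sub>R v) - ?D ((p + \<tau> *\<^sub>R u) + 0 *\<^sub>R v) =
       (s - 0) * frechet_derivative ?D (at ((p + \<tau> *\<^sub>R u) + \<sigma> *\<^sub>R v)) v"
    using MVT2[OF \<open>s > 0\<close> H] by blast
  have "f (p + s *\<^sub>R u + s *\<^sub>R v) - f (p + s *\<^sub>R u) - f (p + s *\<^sub>R v) + f p =
      s * (s * frechet_derivative ?D (at ((p + \<tau> *\<^sub>R u) + \<sigma> *\<^sub>R v)) v)"
    using \<tau>(3) \<sigma>(3) by (simp add: algebra_simps)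
  then show ?thesis
    using \<tau> \<sigma> by (intro bexI[of _ \<tau>] bexI[of _ \<sigma>]) auto
qed

text \<open>Both mixed derivatives, taken at suitable points near \<open>p\<close>, equal the same
  second difference divided by \<open>s * s\<close>. Continuity carries the equality to
  \<open>p\<close>.\<close>

lemma second_derivative_symmetric_real:
  fixes f :: "'a::real_normed_vector \<Rightarrow> real"
  assumes "open S" and f: "smooth_on S f" and "p \<in> S"
  shows "frechet_derivative (\<lambda>q. frechet_derivative f (at q) v) (at p) u =
    frechet_derivative (\<lambda>q. frechet_derivative f (at q) u) (at p) v"
proof (rule ccontr)
  define F where "F = (\<lambda>u v q. frechet_derivative (\<lambda>q. frechet_derivative f (at q) v) (at q) u)"
  assume "\<not> ?thesis"
  then have "F u v p \<noteq> F v u p"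
    by (simp add: F_def)
  \<comment> \<open>Half the gap: two numbers that lie within \<open>e\<close> of the two different
    limits cannot coincide.\<close>
  define e where "e = \<bar>F u v p - F v u p\<bar> / 2"
  have "e > 0"
    using \<open>F u v p \<noteq> F v u p\<close> by (simp add: e_def)
  have "continuous_on S (F a b)" for a b
    unfolding F_def by (intro smooth_on_continuous_on smooth_on_frechet_derivative f)
  then have "isCont (F a b) p" for a b
    using \<open>open S\<close> \<open>p \<in> S\<close> continuous_on_eq_continuous_at by blast
  then have "\<exists>d>0. \<forall>q. dist q p < d \<longrightarrow> dist (F a b q) (F a b p) < e" for a b
    using \<open>e > 0\<close> unfolding continuous_at_eps_delta by blast
  then obtain d1 d2 where d12: "d1 > 0" "d2 > 0"
      "\<And>q. dist q p < d1 \<Longrightarrow> dist (F u v q) (F u v p) < e"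
      "\<And>q. dist q p < d2 \<Longrightarrow> dist (F v u q) (F v u p) < e"
    by metis
  obtain d3 where d3: "d3 > 0" "ball p d3 \<subseteq> S"
    using \<open>open S\<close> \<open>p \<in> S\<close> openE by blast
  define d where "d = min d3 (min d1 d2)"
  have "d > 0"
    using d12 d3 by (simp add: d_def)
  \<comment> \<open>The parallelogram spanned by \<open>s *\<^sub>R u\<close> and
    \<open>s *\<^sub>R v\<close> at \<open>p\<close> then stays within \<open>d / 2\<close> of
    \<open>p\<close>; the summand 1 keeps the denominator positive when both vectors vanish.\<close>
  define s where "s = d / (2 * (norm u + norm v + 1))"
  have "norm u + norm v + 1 > 0"
    by (smt (verit) norm_ge_zero)
  then have "s > 0"
    using \<open>d > 0\<close> by (simp add: s_def)
  have near: "dist (p + \<tau> *\<^sub>R u + \<sigma> *\<^sub>R v) p < d" if "\<tau> \<in> {0..s}" "\<sigma> \<in> {0..s}" for \<tau> \<sigma>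
  proof -
    have "dist (p + \<tau> *\<^sub>R u + \<sigma> *\<^sub>R v) p \<le> norm (\<tau> *\<^sub>R u) + norm (\<sigma> *\<^sub>R v)"
      by (simp add: dist_norm add.assoc norm_triangle_ineq del: norm_scaleR)
    also have "\<dots> \<le> s * norm u + s * norm v"
      using that by (auto intro!: add_mono mult_right_mono)
    also have "\<dots> \<le> s * (norm u + norm v + 1)"
      using \<open>s > 0\<close> by (simp add: algebra_simps)
    also have "\<dots> = d / 2"
      using \<open>norm u + norm v + 1 > 0\<close> by (simp add: s_def field_simps)
    finally show ?thesis
      using \<open>d > 0\<close> by simp
  qed
  have inS: "p + \<tau> *\<^sub>R u + \<sigma> *\<^sub>R v \<in> S" if "\<tau> \<in> {0..s}" "\<sigma> \<in> {0..s}" for \<tau> \<sigma>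
    using near[OF that] d3 by (auto simp: d_def dist_commute)
  obtain \<tau>1 \<sigma>1 where 1: "\<tau>1 \<in> {0..s}" "\<sigma>1 \<in> {0..s}"
      "f (p + s *\<^sub>R u + s *\<^sub>R v) - f (p + s *\<^sub>R u) - f (p + s *\<^sub>R v) + f p =
       s * s * F v u (p + \<tau>1 *\<^sub>R u + \<sigma>1 *\<^sub>R v)"
    using second_difference_mvt[OF f \<open>s > 0\<close> inS] unfolding F_def by blast
  have inS': "p + \<tau> *\<^sub>R v + \<sigma> *\<^sub>R u \<in> S" if "\<tau> \<in> {0..s}" "\<sigma> \<in> {0..s}" for \<tau> \<sigma>
    using inS[OF that(2,1)] by (simp add: ac_simps)
  obtain \<tau>2 \<sigma>2 where 2: "\<tau>2 \<in> {0..s}" "\<sigma>2 \<in> {0..s}"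
      "f (p + s *\<^sub>R v + s *\<^sub>R u) - f (p + s *\<^sub>R v) - f (p + s *\<^sub>R u) + f p =
       s * s * F u v (p + \<tau>2 *\<^sub>R v + \<sigma>2 *\<^sub>R u)"
    using second_difference_mvt[OF f \<open>s > 0\<close> inS'] unfolding F_def by blast
  have "s * s * F v u (p + \<tau>1 *\<^sub>R u + \<sigma>1 *\<^sub>R v) = s * s * F u v (p + \<sigma>2 *\<^sub>R u + \<tau>2 *\<^sub>R v)"
    using 1(3) 2(3) by (simp add: algebra_simps)
  then have "F v u (p + \<tau>1 *\<^sub>R u + \<sigma>1 *\<^sub>R v) = F u v (p + \<sigma>2 *\<^sub>R u + \<tau>2 *\<^sub>R v)"
    using \<open>s > 0\<close> by simp
  moreover have "\<bar>F u v (p + \<sigma>2 *\<^sub>R u + \<tau>2 *\<^sub>R v) - F u v p\<bar> < e"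
    using d12(3) near[OF 2(2,1)] by (auto simp: d_def dist_real_def)
  moreover have "\<bar>F v u (p + \<tau>1 *\<^sub>R u + \<sigma>1 *\<^sub>R v) - F v u p\<bar> < e"
    using d12(4) near[OF 1(1,2)] by (auto simp: d_def dist_real_def)
  ultimately show False
    by (simp add: e_def abs_if split: if_splits)
qed

lemma frechet_derivative_linear:
  assumes "bounded_linear L" "smooth_on S f" "p \<in> S"
  shows "frechet_derivative (\<lambda>q. L (f q)) (at p) v = L (frechet_derivative f (at p) v)"
  using frechet_derivative_at[OF bounded_linear.has_derivative[OF assms(1) smooth_on_has_derivative[OF assms(2,3)]]]
  by metis

lemma second_derivative_symmetric:
  fixes f :: "'a::real_normed_vector \<Rightarrow> 'b::euclidean_space"
  assumes "open S" and f: "smooth_on S f" and "p \<in> S"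
  shows "frechet_derivative (\<lambda>q. frechet_derivative f (at q) v) (at p) u =
    frechet_derivative (\<lambda>q. frechet_derivative f (at q) u) (at p) v"
proof (rule euclidean_eqI)
  fix b :: 'b
  have eq: "frechet_derivative (\<lambda>q. frechet_derivative f (at q) a) (at p) c \<bullet> b =
      frechet_derivative (\<lambda>q. frechet_derivative (\<lambda>q. f q \<bullet> b) (at q) a) (at p) c" for a c
  proof -
    have "frechet_derivative (\<lambda>q. frechet_derivative f (at q) a) (at p) c \<bullet> b =
        frechet_derivative (\<lambda>q. frechet_derivative f (at q) a \<bullet> b) (at p) c"
      by (rule frechet_derivative_linear[OF bounded_linear_inner_left, symmetric])
        (auto intro: smooth_on_frechet_derivative f \<open>p \<in> S\<close>)
    also have "\<dots> = frechet_derivative (\<lambda>q. frechet_derivative (\<lambda>q. f q \<bullet> b) (at q) a) (at p) c"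
    proof -
      have "((\<lambda>q. frechet_derivative f (at q) a \<bullet> b) has_derivative
        frechet_derivative (\<lambda>q. frechet_derivative f (at q) a \<bullet> b) (at p)) (at p)"
        by (intro smooth_on_has_derivative[of S] smooth_on_linear[OF bounded_linear_inner_left]
          smooth_on_frechet_derivative assms)
      then have "((\<lambda>q. frechet_derivative (\<lambda>q. f q \<bullet> b) (at q) a) has_derivative
        frechet_derivative (\<lambda>q. frechet_derivative f (at q) a \<bullet> b) (at p)) (at p)"
        by (rule has_derivative_transform_within_open[OF _ \<open>open S\<close> \<open>p \<in> S\<close>])
          (rule frechet_derivative_linear[OF bounded_linear_inner_left f, symmetric])
      then show ?thesis
        by (rule fun_cong[OF frechet_derivative_at])
    qed
    finally show ?thesis .
  qed
  show "frechet_derivative (\<lambda>q. frechet_derivative f (at q) v) (at p) u \<bullet> b =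
      frechet_derivative (\<lambda>q. frechet_derivative f (at q) u) (at p) v \<bullet> b"
    unfolding eq
    by (rule second_derivative_symmetric_real[OF assms(1) _ assms(3)])
      (rule smooth_on_linear[OF bounded_linear_inner_left assms(1) f])
qed

text \<open>The direction is frozen to \<open>Z p\<close> in the second-derivative term, so that
  this term has the form to which symmetry of second derivatives applies.\<close>

lemma has_derivative_directional_derivative:
  fixes f :: "'a::euclidean_space \<Rightarrow> 'b::real_normed_vector"
  assumes "open S" and f: "smooth_on S f" and Z: "smooth_on S Z" and "p \<in> S"
  shows "((\<lambda>q. frechet_derivative f (at q) (Z q)) has_derivative
    (\<lambda>u. frechet_derivative (\<lambda>q. frechet_derivative f (at q) (Z p)) (at p) u
       + frechet_derivative f (at p) (frechet_derivative Z (at p) u))) (at p)"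
proof -
  let ?D = "\<lambda>b q. frechet_derivative f (at q) b"
  have "((\<lambda>q. \<Sum>b\<in>Basis. (Z q \<bullet> b) *\<^sub>R ?D b q) has_derivative
    (\<lambda>u. \<Sum>b\<in>Basis. (Z p \<bullet> b) *\<^sub>R frechet_derivative (?D b) (at p) u
       + (frechet_derivative Z (at p) u \<bullet> b) *\<^sub>R ?D b p)) (at p)"
    by (intro has_derivative_sum has_derivative_scaleR has_derivative_inner_left
        smooth_on_has_derivative[of S] smooth_on_frechet_derivative assms)
  then have 1: "((\<lambda>q. ?D (Z q) q) has_derivative
    (\<lambda>u. \<Sum>b\<in>Basis. (Z p \<bullet> b) *\<^sub>R frechet_derivative (?D b) (at p) u
       + (frechet_derivative Z (at p) u \<bullet> b) *\<^sub>R ?D b p)) (at p)"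
    by (rule has_derivative_transform_within_open[OF _ assms(1,4)])
      (rule frechet_derivative_basis_expansion[OF f, symmetric])
  have "((\<lambda>q. \<Sum>b\<in>Basis. (Z p \<bullet> b) *\<^sub>R ?D b q) has_derivative
    (\<lambda>u. \<Sum>b\<in>Basis. (Z p \<bullet> b) *\<^sub>R frechet_derivative (?D b) (at p) u)) (at p)"
    by (intro has_derivative_sum has_derivative_scaleR_right
        smooth_on_has_derivative[of S] smooth_on_frechet_derivative assms)
  then have "(?D (Z p) has_derivative
    (\<lambda>u. \<Sum>b\<in>Basis. (Z p \<bullet> b) *\<^sub>R frechet_derivative (?D b) (at p) u)) (at p)"
    by (rule has_derivative_transform_within_open[OF _ assms(1,4)])
      (rule frechet_derivative_basis_expansion[OF f, symmetric])
  then have 2: "frechet_derivative (?D (Z p)) (at p) =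
      (\<lambda>u. \<Sum>b\<in>Basis. (Z p \<bullet> b) *\<^sub>R frechet_derivative (?D b) (at p) u)"
    by (rule frechet_derivative_at[symmetric])
  have 3: "frechet_derivative f (at p) (frechet_derivative Z (at p) u) =
      (\<Sum>b\<in>Basis. (frechet_derivative Z (at p) u \<bullet> b) *\<^sub>R ?D b p)" for u
    by (rule frechet_derivative_basis_expansion[OF f \<open>p \<in> S\<close>])
  show ?thesis
    using 1 by (simp only: sum.distrib 2 3)
qed

text \<open>Only the derivative in the single direction \<open>p - q\<close> has to vanish. This
  covers constancy on all of \<open>S\<close> as well as constancy on the slices where the third
  coordinate is fixed.\<close>

lemma constant_along_segment:
  fixes f :: "'a::real_normed_vector \<Rightarrow> real"
  assumes f: "smooth_on S f" and "convex S" "p \<in> S" "q \<in> S"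
    and "\<And>z. z \<in> S \<Longrightarrow> frechet_derivative f (at z) (p - q) = 0"
  shows "f p = f q"
proof -
  have "q + s *\<^sub>R (p - q) \<in> S" if "0 \<le> s" "s \<le> 1" for s
    using convexD_alt[OF \<open>convex S\<close> \<open>q \<in> S\<close> \<open>p \<in> S\<close> that] by (simp add: algebra_simps)
  then have "((\<lambda>s. f (q + s *\<^sub>R (p - q))) has_real_derivative 0) (at s)" if "0 \<le> s" "s \<le> 1" for s
    using has_real_derivative_along_line[OF f, of q s "p - q"] assms(5) that by auto
  from MVT2[OF zero_less_one this] show ?thesis
    by auto
qed

section \<open>Connection, curvature and Lie derivatives\<close>

lemma has_derivative_vec_nth [derivative_intros]:
  "(f has_derivative f') F \<Longrightarrow> ((\<lambda>p. f p $ i) has_derivative (\<lambda>u. f' u $ i)) F"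
  by (rule bounded_linear.has_derivative[OF bounded_linear_vec_nth])

lemma has_derivative_vec_componentwise:
  fixes f :: "'a::real_normed_vector \<Rightarrow> real ^ 'n"
  assumes "\<And>i. ((\<lambda>p. f p $ i) has_derivative (\<lambda>u. f' u $ i)) (at p within S)"
  shows "(f has_derivative f') (at p within S)"
  using assms unfolding has_derivative_componentwise_within[of f]
  by (auto simp: Basis_vec_def inner_axis)

lemma matrix_inv_unique:
  assumes "A ** B = mat 1" "B ** A = mat 1"
  shows "matrix_inv A = B"
proof -
  have "A ** matrix_inv A = mat 1 \<and> matrix_inv A ** A = mat 1"
    unfolding matrix_inv_def by (rule someI[of _ B]) (use assms in auto)
  then show ?thesis
    by (metis assms(2) matrix_mul_assoc matrix_mul_lid matrix_mul_rid)
qed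

text \<open>The term \<open>\<Gamma>(u, v)\<close> of the connection at \<open>p\<close>. It is linear in \<open>p\<close> as well, so its derivative
  in the base point along \<open>w\<close> is \<open>cw_gamma \<epsilon> w u v\<close>.\<close>

definition cw_gamma :: "real \<Rightarrow> real ^ 3 \<Rightarrow> real ^ 3 \<Rightarrow> real ^ 3 \<Rightarrow> real ^ 3" where
  "cw_gamma \<epsilon> p u v =
     vector [- \<epsilon> * p $ 2 * (u $ 2 * v $ 3 + u $ 3 * v $ 2), \<epsilon> * p $ 2 * (u $ 3 * v $ 3), 0]"

definition cw_curvature :: "real \<Rightarrow> real ^ 3 \<Rightarrow> real ^ 3 \<Rightarrow> real ^ 3 \<Rightarrow> real ^ 3" where
  "cw_curvature \<epsilon> u v w = (\<epsilon> * (u $ 2 * v $ 3 - u $ 3 * v $ 2)) *\<^sub>R vector [- w $ 2, w $ 3, 0]"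

definition cw_product :: "real \<Rightarrow> real ^ 3 \<Rightarrow> real ^ 3 \<Rightarrow> real ^ 3 \<Rightarrow> real" where
  "cw_product \<epsilon> p u v = u $ 1 * v $ 3 + u $ 3 * v $ 1 + u $ 2 * v $ 2 - \<epsilon> * (p $ 2)\<^sup>2 * (u $ 3 * v $ 3)"

section \<open>The metric, its inverse and its connection in coordinates\<close>

lemma cw_metric_nth:
  "cw_metric \<epsilon> p $ 1 = vector [0, 0, 1]"
  "cw_metric \<epsilon> p $ 2 = vector [0, 1, 0]"
  "cw_metric \<epsilon> p $ 3 = vector [1, 0, - \<epsilon> * (p $ 2)\<^sup>2]"
  by (simp_all add: cw_metric_def walker_metric_def)

lemma metric_tensor_cw: "metric_tensor (cw_metric \<epsilon>) Y Z p = cw_product \<epsilon> p (Y p) (Z p)"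
  by (simp add: metric_tensor_def cw_product_def inner_vec_def matrix_vector_mult_def sum_3 cw_metric_nth
      algebra_simps)

lemma matrix_inv_cw:
  "matrix_inv (cw_metric \<epsilon> p) = vector [vector [\<epsilon> * (p $ 2)\<^sup>2, 0, 1], vector [0, 1, 0], vector [1, 0, 0]]"
  by (rule matrix_inv_unique)
    (simp_all add: vec_eq_iff forall_3 matrix_matrix_mult_def sum_3 cw_metric_nth mat_def)

lemma frechet_derivative_cw_metric_entry:
  "frechet_derivative (\<lambda>q. - (\<epsilon> * (q $ 2)\<^sup>2)) (at p) = (\<lambda>u :: real ^ 3. - (2 * \<epsilon> * p $ 2 * u $ 2))"
  by (rule frechet_derivative_at[symmetric]) (auto intro!: derivative_eq_intros)

text \<open>Only the \<open>dy^2\<close> entry of the metric varies, and only with x. Up to symmetry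
  the nonzero Christoffel symbols are - \<epsilon> x, with upper index t and lower indices x, y, and
  \<epsilon> x, with upper index x and lower indices y, y.\<close>

lemma levi_civita_cw:
  "levi_civita (cw_metric \<epsilon>) Y Z = (\<lambda>p. dir_deriv Y Z p + cw_gamma \<epsilon> p (Y p) (Z p))"
proof
  fix p
  show "levi_civita (cw_metric \<epsilon>) Y Z p = dir_deriv Y Z p + cw_gamma \<epsilon> p (Y p) (Z p)"
    by (simp add: levi_civita_def christoffel_def matrix_inv_cw sum_3 cw_metric_nth dir_deriv_def
        coord_field_def frechet_derivative_cw_metric_entry cw_gamma_def vec_eq_iff forall_3 axis_def
        algebra_simps)
qed

lemma has_derivative_cw_gamma:
  assumes "(Y has_derivative Y') (at p)" "(Z has_derivative Z') (at p)"
  shows "((\<lambda>q. cw_gamma \<epsilon> q (Y q) (Z q)) has_derivative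
    (\<lambda>u. cw_gamma \<epsilon> u (Y p) (Z p) + cw_gamma \<epsilon> p (Y' u) (Z p) + cw_gamma \<epsilon> p (Y p) (Z' u))) (at p)"
proof (rule has_derivative_vec_componentwise)
  fix i :: 3
  consider "i = 1" | "i = 2" | "i = 3"
    using exhaust_3 by blast
  then show "((\<lambda>q. cw_gamma \<epsilon> q (Y q) (Z q) $ i) has_derivative
    (\<lambda>u. (cw_gamma \<epsilon> u (Y p) (Z p) + cw_gamma \<epsilon> p (Y' u) (Z p) + cw_gamma \<epsilon> p (Y p) (Z' u)) $ i)) (at p)"
    unfolding cw_gamma_def
    by cases (auto intro!: derivative_eq_intros assms simp: algebra_simps)
qed

lemma has_derivative_cw_curvature:
  assumes "(Y has_derivative Y') (at p)" "(Z has_derivative Z') (at p)" "(W has_derivative W') (at p)"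
  shows "((\<lambda>q. cw_curvature \<epsilon> (Y q) (Z q) (W q)) has_derivative
    (\<lambda>u. cw_curvature \<epsilon> (Y' u) (Z p) (W p) + cw_curvature \<epsilon> (Y p) (Z' u) (W p)
       + cw_curvature \<epsilon> (Y p) (Z p) (W' u))) (at p)"
proof (rule has_derivative_vec_componentwise)
  fix i :: 3
  consider "i = 1" | "i = 2" | "i = 3"
    using exhaust_3 by blast
  then show "((\<lambda>q. cw_curvature \<epsilon> (Y q) (Z q) (W q) $ i) has_derivative
    (\<lambda>u. (cw_curvature \<epsilon> (Y' u) (Z p) (W p) + cw_curvature \<epsilon> (Y p) (Z' u) (W p)
       + cw_curvature \<epsilon> (Y p) (Z p) (W' u)) $ i)) (at p)"
    unfolding cw_curvature_def
    by cases (auto intro!: derivative_eq_intros assms simp: algebra_simps)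
qed

text \<open>The closed forms of curvature and Ricci tensor hold for smooth arguments, and a Lie
  derivative inserts brackets with X into these arguments.\<close>

lemma smooth_on_lie_bracket:
  assumes "open M" "smooth_on M X" "smooth_on M Y"
  shows "smooth_on M (lie_bracket X Y)"
  unfolding lie_bracket_def dir_deriv_def
  by (intro smooth_on_diff smooth_on_directional_derivative assms)

text \<open>Curvature and Ricci tensor agree with their closed forms on \<open>M\<close> only;
  openness allows the derivative to be read off from the closed form.\<close>

lemma frechet_derivative_cong_open:
  assumes "open S" "p \<in> S" "\<And>q. q \<in> S \<Longrightarrow> f q = g q" "(g has_derivative g') (at p)"
  shows "frechet_derivative f (at p) = g'"
  by (rule frechet_derivative_at[symmetric],
      rule has_derivative_transform_within_open[OF assms(4,1,2)]) (simp add: assms(3))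

lemma has_derivative_levi_civita_cw:
  assumes "open M" "smooth_on M Z" "smooth_on M W" "p \<in> M"
  shows "(levi_civita (cw_metric \<epsilon>) Z W has_derivative
    (\<lambda>u. frechet_derivative (\<lambda>q. frechet_derivative W (at q) (Z p)) (at p) u
       + frechet_derivative W (at p) (frechet_derivative Z (at p) u)
       + (cw_gamma \<epsilon> u (Z p) (W p) + cw_gamma \<epsilon> p (frechet_derivative Z (at p) u) (W p)
          + cw_gamma \<epsilon> p (Z p) (frechet_derivative W (at p) u)))) (at p)"
  unfolding levi_civita_cw dir_deriv_def
  by (intro has_derivative_add has_derivative_directional_derivative[OF assms(1)] has_derivative_cw_gamma
      smooth_on_has_derivative[of M] assms)

text \<open>Second derivatives of \<open>W\<close> cancel by symmetry, first derivatives of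
  \<open>Y\<close> and \<open>Z\<close> against the bracket term. The terms quadratic in the
  Christoffel symbols are symmetric in \<open>Y\<close> and \<open>Z\<close> and cancel too, so only
  the base-point derivative of \<open>cw_gamma\<close>, antisymmetrised, survives.\<close>

lemma curvature_cw:
  assumes "open M" "smooth_on M Y" "smooth_on M Z" "smooth_on M W" "p \<in> M"
  shows "curvature (cw_metric \<epsilon>) Y Z W p = cw_curvature \<epsilon> (Y p) (Z p) (W p)"
proof -
  have lin: "linear (frechet_derivative W (at p))"
    using smooth_on_has_derivative[OF assms(4,5)] has_derivative_linear by blast
  have "frechet_derivative (\<lambda>q. frechet_derivative W (at q) (Z p)) (at p) (Y p) =
      frechet_derivative (\<lambda>q. frechet_derivative W (at q) (Y p)) (at p) (Z p)"
    by (rule second_derivative_symmetric[OF assms(1,4,5)])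
  moreover have "dir_deriv V (levi_civita (cw_metric \<epsilon>) U W) p =
      frechet_derivative (\<lambda>q. frechet_derivative W (at q) (U p)) (at p) (V p)
       + frechet_derivative W (at p) (frechet_derivative U (at p) (V p))
       + (cw_gamma \<epsilon> (V p) (U p) (W p) + cw_gamma \<epsilon> p (frechet_derivative U (at p) (V p)) (W p)
          + cw_gamma \<epsilon> p (U p) (frechet_derivative W (at p) (V p)))"
    if "smooth_on M U" for U V
    unfolding dir_deriv_def
    by (rule fun_cong[OF frechet_derivative_at[symmetric]])
      (rule has_derivative_levi_civita_cw[OF assms(1) that assms(4,5)])
  ultimately have "curvature (cw_metric \<epsilon>) Y Z W p =
      cw_gamma \<epsilon> (Y p) (Z p) (W p) - cw_gamma \<epsilon> (Z p) (Y p) (W p)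
      + cw_gamma \<epsilon> p (frechet_derivative Z (at p) (Y p)) (W p)
      + cw_gamma \<epsilon> p (Z p) (frechet_derivative W (at p) (Y p))
      - cw_gamma \<epsilon> p (frechet_derivative Y (at p) (Z p)) (W p)
      - cw_gamma \<epsilon> p (Y p) (frechet_derivative W (at p) (Z p))
      + cw_gamma \<epsilon> p (Y p) (frechet_derivative W (at p) (Z p) + cw_gamma \<epsilon> p (Z p) (W p))
      - cw_gamma \<epsilon> p (Z p) (frechet_derivative W (at p) (Y p) + cw_gamma \<epsilon> p (Y p) (W p))
      - cw_gamma \<epsilon> p (frechet_derivative Z (at p) (Y p) - frechet_derivative Y (at p) (Z p)) (W p)"
    using assms(2,3)
    by (simp add: curvature_def levi_civita_cw[of _ Y "levi_civita _ Z W"] levi_civita_cw[of _ Z "levi_civita _ Y W"]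
        levi_civita_cw[of _ "lie_bracket Y Z"])
      (simp add: levi_civita_cw lie_bracket_def dir_deriv_def linear_diff[OF lin])
  also have "\<dots> = cw_curvature \<epsilon> (Y p) (Z p) (W p)"
    by (simp add: vec_eq_iff forall_3 cw_gamma_def cw_curvature_def algebra_simps)
  finally show ?thesis .
qed

text \<open>Only the x direction contributes to the trace: the image of the curvature has no y
  component, and the curvature vanishes when its first argument is the t direction.\<close>

lemma ricci_cw:
  assumes "open M" "smooth_on M Y" "smooth_on M Z" "p \<in> M"
  shows "ricci (cw_metric \<epsilon>) Y Z p = \<epsilon> * (Y p $ 3 * Z p $ 3)"
  unfolding ricci_def sum_3 coord_field_def
  by (simp add: curvature_cw[OF assms(1) smooth_on_const assms(2-4)] cw_curvature_def axis_def)

text \<open>The derivatives of \<open>Y\<close> and \<open>Z\<close> along \<open>X\<close> cancel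
  against the brackets. The last term is the derivative of the coefficient - \<epsilon> x^2 along
  \<open>X\<close>.\<close>

lemma lie_bilinear_metric_cw:
  assumes "open M" "smooth_on M X" "smooth_on M Y" "smooth_on M Z" "p \<in> M"
  shows "lie_bilinear X (metric_tensor (cw_metric \<epsilon>)) Y Z p =
    cw_product \<epsilon> p (frechet_derivative X (at p) (Y p)) (Z p)
    + cw_product \<epsilon> p (Y p) (frechet_derivative X (at p) (Z p))
    - 2 * \<epsilon> * p $ 2 * X p $ 2 * (Y p $ 3 * Z p $ 3)"
proof -
  have Y: "(Y has_derivative frechet_derivative Y (at p)) (at p)"
    and Z: "(Z has_derivative frechet_derivative Z (at p)) (at p)"
    by (rule smooth_on_has_derivative[OF _ assms(5)], fact)+
  have "frechet_derivative (\<lambda>q. cw_product \<epsilon> q (Y q) (Z q)) (at p) =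
     (\<lambda>u. cw_product \<epsilon> p (frechet_derivative Y (at p) u) (Z p)
       + cw_product \<epsilon> p (Y p) (frechet_derivative Z (at p) u)
       - 2 * \<epsilon> * p $ 2 * u $ 2 * (Y p $ 3 * Z p $ 3))"
    unfolding cw_product_def
    by (rule frechet_derivative_at[symmetric])
      (auto intro!: derivative_eq_intros Y Z simp: algebra_simps)
  then show ?thesis
    unfolding lie_bilinear_def metric_tensor_cw[abs_def] dir_deriv_def lie_bracket_def
    by (simp add: cw_product_def algebra_simps)
qed

lemma lie_bilinear_ricci_cw:
  assumes "open M" "smooth_on M X" "smooth_on M Y" "smooth_on M Z" "p \<in> M"
  shows "lie_bilinear X (ricci (cw_metric \<epsilon>)) Y Z p =
    \<epsilon> * (frechet_derivative X (at p) (Y p) $ 3 * Z p $ 3 + Y p $ 3 * frechet_derivative X (at p) (Z p) $ 3)"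
proof -
  have Y: "(Y has_derivative frechet_derivative Y (at p)) (at p)"
    and Z: "(Z has_derivative frechet_derivative Z (at p)) (at p)"
    by (rule smooth_on_has_derivative[OF _ assms(5)], fact)+
  have "frechet_derivative (ricci (cw_metric \<epsilon>) Y Z) (at p) =
     (\<lambda>u. \<epsilon> * (frechet_derivative Y (at p) u $ 3 * Z p $ 3 + Y p $ 3 * frechet_derivative Z (at p) u $ 3))"
    by (rule frechet_derivative_cong_open[OF assms(1,5) ricci_cw[OF assms(1,3,4)]], assumption)
      (auto intro!: derivative_eq_intros Y Z simp: algebra_simps)
  then show ?thesis
    unfolding lie_bilinear_def
    by (simp add: ricci_cw[OF assms(1)] smooth_on_lie_bracket assms)
      (simp add: dir_deriv_def lie_bracket_def algebra_simps)
qed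

text \<open>The second derivatives of \<open>Z\<close> cancel by symmetry, all first derivatives of
  \<open>Y\<close> and \<open>Z\<close> by bilinearity of the Christoffel term. The Hessian of
  \<open>X\<close> survives, so the affine condition is of second order.\<close>

lemma lie_connection_cw:
  assumes "open M" "smooth_on M X" "smooth_on M Y" "smooth_on M Z" "p \<in> M"
  shows "lie_connection X (levi_civita (cw_metric \<epsilon>)) Y Z p =
    frechet_derivative (\<lambda>q. frechet_derivative X (at q) (Z p)) (at p) (Y p)
    + cw_gamma \<epsilon> (X p) (Y p) (Z p)
    + cw_gamma \<epsilon> p (frechet_derivative X (at p) (Y p)) (Z p)
    + cw_gamma \<epsilon> p (Y p) (frechet_derivative X (at p) (Z p))
    - frechet_derivative X (at p) (cw_gamma \<epsilon> p (Y p) (Z p))"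
proof -
  have linX: "linear (frechet_derivative X (at p))" and linZ: "linear (frechet_derivative Z (at p))"
    using smooth_on_has_derivative[OF _ assms(5)] has_derivative_linear assms by blast+
  have "((\<lambda>q. frechet_derivative Z (at q) (X q) - frechet_derivative X (at q) (Z q)) has_derivative
    (\<lambda>u. frechet_derivative (\<lambda>q. frechet_derivative Z (at q) (X p)) (at p) u
       + frechet_derivative Z (at p) (frechet_derivative X (at p) u)
       - (frechet_derivative (\<lambda>q. frechet_derivative X (at q) (Z p)) (at p) u
       + frechet_derivative X (at p) (frechet_derivative Z (at p) u)))) (at p)"
    by (intro has_derivative_diff has_derivative_directional_derivative[OF assms(1)] assms)
  then have 1: "frechet_derivative (lie_bracket X Z) (at p) =
    (\<lambda>u. frechet_derivative (\<lambda>q. frechet_derivative Z (at q) (X p)) (at p) u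
       + frechet_derivative Z (at p) (frechet_derivative X (at p) u)
       - (frechet_derivative (\<lambda>q. frechet_derivative X (at q) (Z p)) (at p) u
       + frechet_derivative X (at p) (frechet_derivative Z (at p) u)))"
    unfolding lie_bracket_def dir_deriv_def by (rule frechet_derivative_at[symmetric])
  have 2: "frechet_derivative (\<lambda>q. frechet_derivative Z (at q) (X p)) (at p) (Y p) =
      frechet_derivative (\<lambda>q. frechet_derivative Z (at q) (Y p)) (at p) (X p)"
    by (rule second_derivative_symmetric[OF assms(1,4,5)])
  note 3 = frechet_derivative_at[OF has_derivative_levi_civita_cw[OF assms(1,3,4,5)], symmetric]
  have "lie_connection X (levi_civita (cw_metric \<epsilon>)) Y Z p =
     frechet_derivative (levi_civita (cw_metric \<epsilon>) Y Z) (at p) (X p)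
     - frechet_derivative X (at p) (levi_civita (cw_metric \<epsilon>) Y Z p)
     - levi_civita (cw_metric \<epsilon>) (lie_bracket X Y) Z p - levi_civita (cw_metric \<epsilon>) Y (lie_bracket X Z) p"
    by (simp add: lie_connection_def lie_bracket_def[of X "levi_civita (cw_metric \<epsilon>) Y Z"] dir_deriv_def)
  also have "\<dots> = frechet_derivative (\<lambda>q. frechet_derivative X (at q) (Z p)) (at p) (Y p)
    + cw_gamma \<epsilon> (X p) (Y p) (Z p)
    + cw_gamma \<epsilon> p (frechet_derivative Y (at p) (X p)) (Z p)
    + cw_gamma \<epsilon> p (Y p) (frechet_derivative Z (at p) (X p))
    - cw_gamma \<epsilon> p (frechet_derivative Y (at p) (X p) - frechet_derivative X (at p) (Y p)) (Z p)
    - cw_gamma \<epsilon> p (Y p) (frechet_derivative Z (at p) (X p) - frechet_derivative X (at p) (Z p))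
    - frechet_derivative X (at p) (cw_gamma \<epsilon> p (Y p) (Z p))"
    unfolding 3
    by (simp add: levi_civita_cw dir_deriv_def 1 2)
      (simp add: lie_bracket_def dir_deriv_def linear_diff[OF linZ] linear_add[OF linX])
  also have "\<dots> = frechet_derivative (\<lambda>q. frechet_derivative X (at q) (Z p)) (at p) (Y p)
    + cw_gamma \<epsilon> (X p) (Y p) (Z p)
    + cw_gamma \<epsilon> p (frechet_derivative X (at p) (Y p)) (Z p)
    + cw_gamma \<epsilon> p (Y p) (frechet_derivative X (at p) (Z p))
    - frechet_derivative X (at p) (cw_gamma \<epsilon> p (Y p) (Z p))"
  proof -
    have "cw_gamma \<epsilon> p (a - b) c = cw_gamma \<epsilon> p a c - cw_gamma \<epsilon> p b c"
      "cw_gamma \<epsilon> p c (a - b) = cw_gamma \<epsilon> p c a - cw_gamma \<epsilon> p c b" for a b c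
      by (simp_all add: vec_eq_iff forall_3 cw_gamma_def algebra_simps)
    then show ?thesis
      by simp
  qed
  finally show ?thesis .
qed

lemma lie_trilinear_curvature_cw:
  assumes "open M" "smooth_on M X" "smooth_on M Y" "smooth_on M Z" "smooth_on M W" "p \<in> M"
  shows "lie_trilinear X (curvature (cw_metric \<epsilon>)) Y Z W p =
    cw_curvature \<epsilon> (frechet_derivative X (at p) (Y p)) (Z p) (W p)
    + cw_curvature \<epsilon> (Y p) (frechet_derivative X (at p) (Z p)) (W p)
    + cw_curvature \<epsilon> (Y p) (Z p) (frechet_derivative X (at p) (W p))
    - frechet_derivative X (at p) (cw_curvature \<epsilon> (Y p) (Z p) (W p))"
proof -
  have 1: "frechet_derivative (curvature (cw_metric \<epsilon>) Y Z W) (at p) =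
    (\<lambda>u. cw_curvature \<epsilon> (frechet_derivative Y (at p) u) (Z p) (W p)
       + cw_curvature \<epsilon> (Y p) (frechet_derivative Z (at p) u) (W p)
       + cw_curvature \<epsilon> (Y p) (Z p) (frechet_derivative W (at p) u))"
    by (rule frechet_derivative_cong_open[OF assms(1,6) curvature_cw[OF assms(1,3,4,5)]], assumption)
      (intro has_derivative_cw_curvature smooth_on_has_derivative[of M] assms)
  have 2: "cw_curvature \<epsilon> (a - b) c d = cw_curvature \<epsilon> a c d - cw_curvature \<epsilon> b c d"
    "cw_curvature \<epsilon> c (a - b) d = cw_curvature \<epsilon> c a d - cw_curvature \<epsilon> c b d"
    "cw_curvature \<epsilon> c d (a - b) = cw_curvature \<epsilon> c d a - cw_curvature \<epsilon> c d b" for a b c d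
    by (simp_all add: vec_eq_iff forall_3 cw_curvature_def algebra_simps)
  show ?thesis
    unfolding lie_trilinear_def lie_bracket_def[of X "curvature (cw_metric \<epsilon>) Y Z W"] dir_deriv_def 1
    by (simp add: curvature_cw[OF assms(1)] smooth_on_lie_bracket assms)
      (simp add: dir_deriv_def lie_bracket_def 2)
qed

text \<open>Constant fields with values \<open>u\<close> and \<open>v\<close> probe the equation at
  a point; conversely the pointwise identity is applied to the values of \<open>Y\<close> and
  \<open>Z\<close>. The factor \<open>\<eta>\<close> stays a parameter because the value 0 gives the
  Killing equation.\<close>

lemma homothetic_equation_cw_iff:
  assumes "open M" "smooth_on M X"
  shows "(\<forall>Y Z. smooth_on M Y \<longrightarrow> smooth_on M Z \<longrightarrow>
      (\<forall>p\<in>M. lie_bilinear X (metric_tensor (cw_metric \<epsilon>)) Y Z p = \<eta> * metric_tensor (cw_metric \<epsilon>) Y Z p))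
    \<longleftrightarrow> (\<forall>p\<in>M. \<forall>u v. cw_product \<epsilon> p (frechet_derivative X (at p) u) v
      + cw_product \<epsilon> p u (frechet_derivative X (at p) v)
      - 2 * \<epsilon> * p $ 2 * X p $ 2 * (u $ 3 * v $ 3) = \<eta> * cw_product \<epsilon> p u v)"
    (is "?L \<longleftrightarrow> ?R")
proof
  assume ?L
  show ?R
  proof (intro ballI allI)
    fix p u v
    assume "p \<in> M"
    with \<open>?L\<close>[rule_format, OF smooth_on_const smooth_on_const this, of u v]
      lie_bilinear_metric_cw[OF assms smooth_on_const smooth_on_const this, of \<epsilon> u v]
    show "cw_product \<epsilon> p (frechet_derivative X (at p) u) v
      + cw_product \<epsilon> p u (frechet_derivative X (at p) v)
      - 2 * \<epsilon> * p $ 2 * X p $ 2 * (u $ 3 * v $ 3) = \<eta> * cw_product \<epsilon> p u v"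
      by (simp add: metric_tensor_cw)
  qed
qed (simp add: lie_bilinear_metric_cw[OF assms] metric_tensor_cw)

lemma affine_field_cw_iff:
  assumes "open M" "smooth_on M X"
  shows "affine_field M (cw_metric \<epsilon>) X \<longleftrightarrow>
    (\<forall>p\<in>M. \<forall>u v. frechet_derivative (\<lambda>q. frechet_derivative X (at q) v) (at p) u
      + cw_gamma \<epsilon> (X p) u v + cw_gamma \<epsilon> p (frechet_derivative X (at p) u) v
      + cw_gamma \<epsilon> p u (frechet_derivative X (at p) v)
      - frechet_derivative X (at p) (cw_gamma \<epsilon> p u v) = 0)"
    (is "?L \<longleftrightarrow> ?R")
proof
  assume ?L
  show ?R
  proof (intro ballI allI)
    fix p u v
    assume "p \<in> M"
    with \<open>?L\<close>[unfolded affine_field_def, rule_format, OF smooth_on_const smooth_on_const this, of u v]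
    show "frechet_derivative (\<lambda>q. frechet_derivative X (at q) v) (at p) u
      + cw_gamma \<epsilon> (X p) u v + cw_gamma \<epsilon> p (frechet_derivative X (at p) u) v
      + cw_gamma \<epsilon> p u (frechet_derivative X (at p) v)
      - frechet_derivative X (at p) (cw_gamma \<epsilon> p u v) = 0"
      by (simp add: lie_connection_cw[OF assms smooth_on_const smooth_on_const])
  qed
qed (simp add: affine_field_def lie_connection_cw[OF assms])

lemma ricci_collineation_cw_iff:
  assumes "open M" "smooth_on M X" "\<epsilon> \<noteq> 0"
  shows "ricci_collineation M (cw_metric \<epsilon>) X \<longleftrightarrow>
    (\<forall>p\<in>M. \<forall>u v. frechet_derivative X (at p) u $ 3 * v $ 3 + u $ 3 * frechet_derivative X (at p) v $ 3 = 0)"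
    (is "?L \<longleftrightarrow> ?R")
proof
  assume ?L
  show ?R
  proof (intro ballI allI)
    fix p u v
    assume "p \<in> M"
    with \<open>?L\<close>[unfolded ricci_collineation_def, rule_format, OF smooth_on_const smooth_on_const this, of u v]
    show "frechet_derivative X (at p) u $ 3 * v $ 3 + u $ 3 * frechet_derivative X (at p) v $ 3 = 0"
      using \<open>\<epsilon> \<noteq> 0\<close> by (simp add: lie_bilinear_ricci_cw[OF assms(1,2) smooth_on_const smooth_on_const])
  qed
qed (simp add: ricci_collineation_def lie_bilinear_ricci_cw[OF assms(1,2)])

lemma curvature_collineation_cw_iff:
  assumes "open M" "smooth_on M X"
  shows "curvature_collineation M (cw_metric \<epsilon>) X \<longleftrightarrow>
    (\<forall>p\<in>M. \<forall>u v w. cw_curvature \<epsilon> (frechet_derivative X (at p) u) v w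
      + cw_curvature \<epsilon> u (frechet_derivative X (at p) v) w
      + cw_curvature \<epsilon> u v (frechet_derivative X (at p) w)
      - frechet_derivative X (at p) (cw_curvature \<epsilon> u v w) = 0)"
    (is "?L \<longleftrightarrow> ?R")
proof
  assume ?L
  show ?R
  proof (intro ballI allI)
    fix p u v w
    assume "p \<in> M"
    with \<open>?L\<close>[unfolded curvature_collineation_def, rule_format,
        OF smooth_on_const smooth_on_const smooth_on_const this, of u v w]
    show "cw_curvature \<epsilon> (frechet_derivative X (at p) u) v w
      + cw_curvature \<epsilon> u (frechet_derivative X (at p) v) w
      + cw_curvature \<epsilon> u v (frechet_derivative X (at p) w)
      - frechet_derivative X (at p) (cw_curvature \<epsilon> u v w) = 0"
      by (simp add: lie_trilinear_curvature_cw[OF assms smooth_on_const smooth_on_const smooth_on_const])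
  qed
qed (simp add: curvature_collineation_def lie_trilinear_curvature_cw[OF assms])

section \<open>Partial derivatives on convex domains\<close>

definition pd :: "3 \<Rightarrow> (real ^ 3 \<Rightarrow> real) \<Rightarrow> real ^ 3 \<Rightarrow> real" where
  "pd i h p = frechet_derivative h (at p) (axis i 1)"

text \<open>Convexity is what the integrations along segments use. The product shape of the domain
  matters only later, when a function of y alone has to be defined on the whole y-interval.\<close>

locale convex_domain =
  fixes M :: "(real ^ 3) set"
  assumes open_M: "open M" and convex_M: "convex M"
begin

lemma smooth_on_divide_const:
  fixes f :: "real ^ 3 \<Rightarrow> real"
  shows "smooth_on M f \<Longrightarrow> smooth_on M (\<lambda>p. f p / c)"
  by (rule smooth_on_linear[OF bounded_linear_divide open_M])

lemma smooth_on_pd: "smooth_on M h \<Longrightarrow> smooth_on M (pd i h)"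
  unfolding pd_def[abs_def] by (rule smooth_on_frechet_derivative)

lemmas smooth_rules = smooth_on_pd smooth_on_const smooth_on_add[OF open_M] smooth_on_diff[OF open_M]
  smooth_on_minus[OF open_M] smooth_on_mult[OF open_M] smooth_on_power[OF open_M]
  smooth_on_vec_nth[OF open_M] smooth_on_ident smooth_on_divide_const

text \<open>This is how an equation valid on \<open>M\<close> is differentiated: since
  \<open>M\<close> is open, the derivative of one side passes to the other.\<close>

lemma pd_cong:
  assumes "smooth_on M f" "\<And>q. q \<in> M \<Longrightarrow> f q = g q" "p \<in> M"
  shows "pd i f p = pd i g p"
proof -
  have "frechet_derivative f (at p) = frechet_derivative g (at p)"
    using assms(2,3) differentiableI[OF smooth_on_has_derivative[OF assms(1,3)]]
    by (intro frechet_derivative_transform_within_open[OF _ open_M])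
  then show ?thesis
    by (simp add: pd_def)
qed

lemma pd_const: "pd i (\<lambda>q. c) p = 0"
  by (simp add: pd_def)

lemma pd_coord: "pd i (\<lambda>q. q $ j) p = (if i = j then 1 else 0)"
proof -
  have "frechet_derivative (\<lambda>q :: real ^ 3. q $ j) (at p) = (\<lambda>u. u $ j)"
    by (rule frechet_derivative_at[symmetric]) (auto intro!: derivative_eq_intros)
  then show ?thesis
    by (simp add: pd_def axis_def)
qed

lemma pd_add:
  assumes "p \<in> M" "smooth_on M f" "smooth_on M g"
  shows "pd i (\<lambda>q. f q + g q) p = pd i f p + pd i g p"
  unfolding pd_def
  by (rule fun_cong[OF frechet_derivative_at[symmetric]])
    (intro has_derivative_add smooth_on_has_derivative[of M] assms)

lemma pd_diff:
  assumes "p \<in> M" "smooth_on M f" "smooth_on M g"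
  shows "pd i (\<lambda>q. f q - g q) p = pd i f p - pd i g p"
  unfolding pd_def
  by (rule fun_cong[OF frechet_derivative_at[symmetric]])
    (intro has_derivative_diff smooth_on_has_derivative[of M] assms)

lemma pd_minus:
  assumes "p \<in> M" "smooth_on M f"
  shows "pd i (\<lambda>q. - f q) p = - pd i f p"
  using pd_diff[OF assms(1) smooth_on_const assms(2), of i 0] by (simp add: pd_const)

lemma pd_mult:
  assumes "p \<in> M" "smooth_on M f" "smooth_on M g"
  shows "pd i (\<lambda>q. f q * g q) p = f p * pd i g p + pd i f p * g p"
  unfolding pd_def
  by (rule fun_cong[OF frechet_derivative_at[symmetric]])
    (intro has_derivative_mult smooth_on_has_derivative[of M] assms)

lemma pd_square:
  assumes "p \<in> M" "smooth_on M f"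
  shows "pd i (\<lambda>q. (f q)\<^sup>2) p = 2 * f p * pd i f p"
  using pd_mult[OF assms assms(2)] by (simp add: power2_eq_square)

lemma pd_divide_const:
  assumes "p \<in> M" "smooth_on M f"
  shows "pd i (\<lambda>q. f q / c) p = pd i f p / c"
  unfolding pd_def by (rule frechet_derivative_linear[OF bounded_linear_divide assms(2,1)])

lemmas pd_rules = pd_divide_const pd_const pd_coord pd_add pd_diff pd_minus pd_mult pd_square smooth_rules

lemma pd_commute:
  assumes "smooth_on M h" "p \<in> M"
  shows "pd i (pd j h) p = pd j (pd i h) p"
  unfolding pd_def[abs_def] by (rule second_derivative_symmetric[OF open_M assms])

lemma has_real_derivative_pd:
  assumes "smooth_on M h" "q + s *\<^sub>R axis i 1 \<in> M"
  shows "((\<lambda>s. h (q + s *\<^sub>R axis i 1)) has_real_derivative pd i h (q + s *\<^sub>R axis i 1)) (at s)"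
  unfolding pd_def by (rule has_real_derivative_along_line[OF assms])

text \<open>Explicit formulas for components of X are differentiated along a coordinate line, as
  functions of one variable; the smoothness of \<open>h\<close> guarantees that the result is its
  partial derivative.\<close>

lemma pd_eqI:
  assumes "smooth_on M h" "p \<in> M" "\<And>q. q \<in> M \<Longrightarrow> h q = g q"
    and "((\<lambda>s. g (p + s *\<^sub>R axis i 1)) has_real_derivative d) (at 0)"
  shows "pd i h p = d"
proof -
  have 1: "((\<lambda>s. h (p + s *\<^sub>R axis i 1)) has_real_derivative pd i h p) (at 0)"
    using has_real_derivative_pd[OF assms(1), of p 0 i] assms(2) by simp
  have "open ((\<lambda>s. p + s *\<^sub>R axis i 1) -` M)"
    by (intro open_vimage open_M continuous_intros)
  then have "((\<lambda>s. g (p + s *\<^sub>R axis i 1)) has_real_derivative pd i h p) (at 0)"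
    by (rule has_field_derivative_transform_within_open[OF 1]) (use assms(2,3) in auto)
  then show ?thesis
    using assms(4) DERIV_unique by blast
qed

lemma frechet_derivative_pd:
  assumes "smooth_on M h" "p \<in> M"
  shows "frechet_derivative h (at p) u = u $ 1 * pd 1 h p + u $ 2 * pd 2 h p + u $ 3 * pd 3 h p"
proof -
  have lin: "linear (frechet_derivative h (at p))"
    using smooth_on_has_derivative[OF assms] has_derivative_linear by blast
  have "u = u $ 1 *\<^sub>R axis 1 1 + u $ 2 *\<^sub>R axis 2 1 + u $ 3 *\<^sub>R axis 3 1"
    by (simp add: vec_eq_iff forall_3 axis_def)
  then have "frechet_derivative h (at p) u =
      frechet_derivative h (at p) (u $ 1 *\<^sub>R axis 1 1 + u $ 2 *\<^sub>R axis 2 1 + u $ 3 *\<^sub>R axis 3 1)"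
    by simp
  then show ?thesis
    by (simp only: linear_add[OF lin] linear_scale[OF lin] pd_def real_scaleR_def)
qed

lemma frechet_derivative_nth:
  fixes X :: "3 vfield"
  assumes "smooth_on M X" "p \<in> M"
  shows "frechet_derivative X (at p) u $ i = u $ 1 * pd 1 (\<lambda>q. X q $ i) p
    + u $ 2 * pd 2 (\<lambda>q. X q $ i) p + u $ 3 * pd 3 (\<lambda>q. X q $ i) p"
  using frechet_derivative_linear[OF bounded_linear_vec_nth[of i] assms, of u]
    frechet_derivative_pd[OF smooth_on_vec_nth[OF open_M assms(1)] assms(2), of i u] by simp

lemma second_frechet_derivative_nth:
  fixes X :: "3 vfield"
  assumes X: "smooth_on M X" and p: "p \<in> M"
  shows "frechet_derivative (\<lambda>q. frechet_derivative X (at q) v) (at p) u $ i =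
    (\<Sum>k\<in>UNIV. u $ k * (\<Sum>j\<in>UNIV. v $ j * pd k (pd j (\<lambda>q. X q $ i)) p))"
proof -
  let ?V = "\<lambda>q. frechet_derivative X (at q) v"
  have V: "smooth_on M ?V"
    by (rule smooth_on_frechet_derivative[OF X])
  have "pd k (\<lambda>q. ?V q $ i) p = (\<Sum>j\<in>UNIV. v $ j * pd k (pd j (\<lambda>q. X q $ i)) p)" for k
  proof -
    have "pd k (\<lambda>q. ?V q $ i) p = pd k (\<lambda>q. v $ 1 * pd 1 (\<lambda>q. X q $ i) q
        + v $ 2 * pd 2 (\<lambda>q. X q $ i) q + v $ 3 * pd 3 (\<lambda>q. X q $ i) q) p"
      by (rule pd_cong[OF smooth_on_vec_nth[OF open_M V] frechet_derivative_nth[OF X] p])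
    also have "\<dots> = (\<Sum>j\<in>UNIV. v $ j * pd k (pd j (\<lambda>q. X q $ i)) p)"
      by (simp add: pd_rules p X sum_3)
    finally show ?thesis .
  qed
  then show ?thesis
    by (simp add: frechet_derivative_nth[OF V p] sum_3)
qed

lemma constant_if_pd_zero:
  assumes "smooth_on M h" "\<And>p. p \<in> M \<Longrightarrow> pd 1 h p = 0" "\<And>p. p \<in> M \<Longrightarrow> pd 2 h p = 0"
    "\<And>p. p \<in> M \<Longrightarrow> pd 3 h p = 0"
  shows "\<exists>c. \<forall>p\<in>M. h p = c"
proof -
  have "h p = h q" if "p \<in> M" "q \<in> M" for p q
    by (rule constant_along_segment[OF assms(1) convex_M that])
      (simp add: frechet_derivative_pd[OF assms(1)] assms)
  then show ?thesis
    by metis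
qed

lemma depends_only_on_third:
  assumes "smooth_on M h" "\<And>p. p \<in> M \<Longrightarrow> pd 1 h p = 0" "\<And>p. p \<in> M \<Longrightarrow> pd 2 h p = 0"
    and "p \<in> M" "q \<in> M" "p $ 3 = q $ 3"
  shows "h p = h q"
  by (rule constant_along_segment[OF assms(1) convex_M assms(4,5)])
    (simp add: frechet_derivative_pd[OF assms(1)] assms)

end

text \<open>With \<open>DERIV_cw_S\<close> this gives T'' = - \<epsilon> T. The relation d_x X1 = -
  d_y X2 turns T in X2 into S in X1, which is why both components share \<open>c1\<close> and
  \<open>c2\<close>.\<close>

lemma DERIV_cw_T [derivative_intros]:
  assumes "(g has_real_derivative g') (at s)"
  shows "((\<lambda>s. cw_T \<epsilon> c1 c2 (g s)) has_real_derivative - cw_S \<epsilon> c1 c2 (g s) * g') (at s)"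
  unfolding cw_T_def cw_S_def
  by (cases "\<epsilon> = 1") (auto intro!: derivative_eq_intros assms simp: algebra_simps)

lemma DERIV_cw_S:
  assumes "(g has_real_derivative g') (at s)" "\<epsilon> \<in> {1, -1}"
  shows "((\<lambda>s. cw_S \<epsilon> c1 c2 (g s)) has_real_derivative \<epsilon> * cw_T \<epsilon> c1 c2 (g s) * g') (at s)"
  using assms(2) unfolding cw_T_def cw_S_def
  by (cases "\<epsilon> = 1") (auto intro!: derivative_eq_intros assms(1) simp: algebra_simps)

context convex_domain
begin

text \<open>A source of first integrals: for \<open>k = pd 3 h\<close> the second-order equation for
  \<open>h\<close> becomes a condition on \<open>\<phi>\<close> and \<open>\<psi>\<close> under
  which the combination is conserved.\<close>

lemma constant_combination_if_pd_zero:
  assumes "smooth_on M h" "\<And>p. p \<in> M \<Longrightarrow> pd 1 h p = 0" "\<And>p. p \<in> M \<Longrightarrow> pd 2 h p = 0"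
    and "smooth_on M k" "\<And>p. p \<in> M \<Longrightarrow> pd 1 k p = 0" "\<And>p. p \<in> M \<Longrightarrow> pd 2 k p = 0"
    and "\<And>s. (\<phi> has_real_derivative \<phi>' s) (at s)" "\<And>s. (\<psi> has_real_derivative \<psi>' s) (at s)"
    and "\<And>p. p \<in> M \<Longrightarrow> pd 3 h p * \<phi> (p $ 3) + h p * \<phi>' (p $ 3) + pd 3 k p * \<psi> (p $ 3) + k p * \<psi>' (p $ 3) = 0"
  shows "\<exists>c. \<forall>p\<in>M. h p * \<phi> (p $ 3) + k p * \<psi> (p $ 3) = c"
proof -
  let ?f = "\<lambda>p. h p * \<phi> (p $ 3) + k p * \<psi> (p $ 3)"
  have der: "(?f has_derivative (\<lambda>u. 0)) (at p)" if "p \<in> M" for p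
  proof -
    have comp: "((\<lambda>p. f (p $ 3)) has_derivative (\<lambda>u. u $ 3 * f' (p $ 3))) (at p)"
      if "\<And>s. (f has_real_derivative f' s) (at s)" for f f' :: "real \<Rightarrow> real"
      by (rule DERIV_compose_FDERIV[OF that]) (auto intro!: derivative_eq_intros)
    have "(?f has_derivative (\<lambda>u.
        h p * (u $ 3 * \<phi>' (p $ 3)) + frechet_derivative h (at p) u * \<phi> (p $ 3)
        + (k p * (u $ 3 * \<psi>' (p $ 3)) + frechet_derivative k (at p) u * \<psi> (p $ 3)))) (at p)"
      by (intro has_derivative_add has_derivative_mult comp assms smooth_on_has_derivative[of M] that)
    moreover have "h p * (u $ 3 * \<phi>' (p $ 3)) + frechet_derivative h (at p) u * \<phi> (p $ 3)
        + (k p * (u $ 3 * \<psi>' (p $ 3)) + frechet_derivative k (at p) u * \<psi> (p $ 3)) = 0" for u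
    proof -
      have "h p * (u $ 3 * \<phi>' (p $ 3)) + frechet_derivative h (at p) u * \<phi> (p $ 3)
        + (k p * (u $ 3 * \<psi>' (p $ 3)) + frechet_derivative k (at p) u * \<psi> (p $ 3)) = u $ 3 *
        (pd 3 h p * \<phi> (p $ 3) + h p * \<phi>' (p $ 3) + pd 3 k p * \<psi> (p $ 3) + k p * \<psi>' (p $ 3))"
        by (simp add: frechet_derivative_pd[OF assms(1) that] frechet_derivative_pd[OF assms(4) that]
            assms(2,3,5,6) that algebra_simps)
      then show ?thesis
        by (simp add: assms(9) that)
    qed
    ultimately show ?thesis
      by simp
  qed
  show ?thesis
    by (rule has_derivative_zero_constant[OF convex_M])
      (auto intro: has_derivative_at_withinI der)
qed

text \<open>Two first integrals that are linear in h and h' determine both functions by solving a 2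
  by 2 linear system whose coefficients depend on y.\<close>

lemma cw_T_ode:
  assumes \<epsilon>: "\<epsilon> \<in> {1, -1}" and h: "smooth_on M h"
    and h1: "\<And>p. p \<in> M \<Longrightarrow> pd 1 h p = 0" and h2: "\<And>p. p \<in> M \<Longrightarrow> pd 2 h p = 0"
    and ode: "\<And>p. p \<in> M \<Longrightarrow> pd 3 (pd 3 h) p = - \<epsilon> * h p"
  shows "\<exists>c1 c2. \<forall>p\<in>M. h p = cw_T \<epsilon> c1 c2 (p $ 3) \<and> pd 3 h p = - cw_S \<epsilon> c1 c2 (p $ 3)"
proof -
  let ?k = "pd 3 h"
  have k: "smooth_on M ?k"
    by (rule smooth_on_pd[OF h])
  have k12: "pd 1 ?k p = 0" "pd 2 ?k p = 0" if "p \<in> M" for p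
    using pd_commute[OF h that, of _ 3] pd_cong[OF smooth_on_pd[OF h] h1 that, of 3]
      pd_cong[OF smooth_on_pd[OF h] h2 that, of 3] by (simp_all add: pd_const)
  note const = constant_combination_if_pd_zero[OF h h1 h2 k k12]
  show ?thesis
  proof (cases "\<epsilon> = 1")
    case True
    \<comment> \<open>For h'' = - h the pair (h, h') rotates with y; the two integrals are its
      coordinates in the co-rotating frame.\<close>
    obtain c1 where c1: "\<And>p. p \<in> M \<Longrightarrow> h p * sin (p $ 3) + ?k p * cos (p $ 3) = c1"
      using const[OF _ _ _ _ DERIV_sin DERIV_cos] ode True by auto
    obtain c2 where c2: "\<And>p. p \<in> M \<Longrightarrow> h p * cos (p $ 3) + ?k p * - sin (p $ 3) = c2"
      using const[OF _ _ _ _ DERIV_cos DERIV_minus[OF DERIV_sin]] ode True by auto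
    have "h p = c1 * sin (p $ 3) + c2 * cos (p $ 3) \<and> ?k p = c1 * cos (p $ 3) - c2 * sin (p $ 3)"
      if "p \<in> M" for p
      using sin_cos_squared_add[of "p $ 3"] c1[OF that] c2[OF that] by algebra
    then show ?thesis
      using True by (intro exI[of _ c1] exI[of _ c2]) (simp add: cw_T_def cw_S_def)
  next
    case False
    have d: "((\<lambda>s. exp (- s)) has_real_derivative - exp (- s)) (at s)" for s :: real
      by (auto intro!: derivative_eq_intros)
    \<comment> \<open>For h'' = h the combinations h - h' and h + h' are multiples of e^(-y) and
      e^y. Their sum is 2 h, whence the halves in the witnesses below.\<close>
    obtain c1 where c1: "\<And>p. p \<in> M \<Longrightarrow> h p * exp (p $ 3) + ?k p * - exp (p $ 3) = c1"
      using const[OF _ _ _ _ DERIV_exp DERIV_minus[OF DERIV_exp]] ode False \<epsilon> by auto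
    obtain c2 where c2: "\<And>p. p \<in> M \<Longrightarrow> h p * exp (- p $ 3) + ?k p * exp (- p $ 3) = c2"
      using const[OF _ _ _ _ d d] ode False \<epsilon> by auto
    have "h p = c1 / 2 * exp (- p $ 3) + c2 / 2 * exp (p $ 3) \<and>
        ?k p = c2 / 2 * exp (p $ 3) - c1 / 2 * exp (- p $ 3)" if "p \<in> M" for p
    proof -
      have "exp (p $ 3) * exp (- p $ 3) = 1"
        by (simp add: exp_minus)
      then show ?thesis
        using c1[OF that] c2[OF that] by algebra
    qed
    then show ?thesis
      using False by (intro exI[of _ "c1 / 2"] exI[of _ "c2 / 2"]) (simp add: cw_T_def cw_S_def)
  qed
qed

end

section \<open>The systems of partial differential equations\<close>

context convex_domain
begin

text \<open>A solved form of the affine equations for \<open>X = a \<partial>\<^sub>t + b \<partial>\<^sub>x + c \<partial>\<^sub>y\<close>; homothetic fields satisfy it too.\<close>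

definition affine_system ::
  "real \<Rightarrow> (real ^ 3 \<Rightarrow> real) \<Rightarrow> (real ^ 3 \<Rightarrow> real) \<Rightarrow> (real ^ 3 \<Rightarrow> real) \<Rightarrow> bool" where
  "affine_system \<epsilon> a b c \<longleftrightarrow> (\<forall>p\<in>M.
     pd 1 c p = 0 \<and> pd 2 c p = 0 \<and> pd 3 c p = 0 \<and>
     pd 1 b p = 0 \<and> pd 1 (pd 2 b) p = 0 \<and> pd 2 (pd 2 b) p = 0 \<and> pd 3 (pd 2 b) p = 0 \<and>
     pd 3 (pd 3 b) p = - \<epsilon> * (b p - p $ 2 * pd 2 b p) \<and>
     pd 1 a p = 2 * pd 2 b p \<and> pd 2 a p = - pd 3 b p \<and>
     pd 3 (pd 3 a) p = \<epsilon> * p $ 2 * pd 3 b p)"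

text \<open>The equations are triangular: the Christoffel term has no y component, so the third
  component involves X3 alone, the second X2 and X3, the first all three. They are resolved in this
  order, each time by comparing the x-derivative of a second-order equation with the same third
  derivative in another order.\<close>

lemma affine_equation_imp_system:
  assumes \<epsilon>: "\<epsilon> \<noteq> 0" and X: "smooth_on M X"
    and eq: "\<And>p u v. p \<in> M \<Longrightarrow> frechet_derivative (\<lambda>q. frechet_derivative X (at q) v) (at p) u
      + cw_gamma \<epsilon> (X p) u v + cw_gamma \<epsilon> p (frechet_derivative X (at p) u) v
      + cw_gamma \<epsilon> p u (frechet_derivative X (at p) v)
      - frechet_derivative X (at p) (cw_gamma \<epsilon> p u v) = 0"
  shows "affine_system \<epsilon> (\<lambda>p. X p $ 1) (\<lambda>p. X p $ 2) (\<lambda>p. X p $ 3)"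
proof -
  let ?a = "\<lambda>p. X p $ 1" and ?b = "\<lambda>p. X p $ 2" and ?c = "\<lambda>p. X p $ 3"
  have sm: "smooth_on M ?a" "smooth_on M ?b" "smooth_on M ?c"
    by (intro smooth_rules X)+
  note expand = frechet_derivative_nth[OF X] second_frechet_derivative_nth[OF X] sum_3 cw_gamma_def axis_def
  have c2: "pd 1 (pd 2 ?c) p = 0" "pd 2 (pd 2 ?c) p = 0" "pd 2 (pd 1 ?c) p = 0"
      "pd 3 (pd 2 ?c) p = - \<epsilon> * p $ 2 * pd 1 ?c p" "pd 2 (pd 3 ?c) p = - \<epsilon> * p $ 2 * pd 1 ?c p"
      "pd 3 (pd 3 ?c) p = \<epsilon> * p $ 2 * pd 2 ?c p"
    if "p \<in> M" for p
    using eq[OF that, where u = "axis 1 1" and v = "axis 2 1", THEN arg_cong, where f = "\<lambda>z. z $ 3"] eq[OF that, where u = "axis 2 1" and v = "axis 2 1", THEN arg_cong, where f = "\<lambda>z. z $ 3"] eq[OF that, where u = "axis 2 1" and v = "axis 1 1", THEN arg_cong, where f = "\<lambda>z. z $ 3"] eq[OF that, where u = "axis 3 1" and v = "axis 2 1", THEN arg_cong, where f = "\<lambda>z. z $ 3"]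
      eq[OF that, where u = "axis 2 1" and v = "axis 3 1", THEN arg_cong, where f = "\<lambda>z. z $ 3"] eq[OF that, where u = "axis 3 1" and v = "axis 3 1", THEN arg_cong, where f = "\<lambda>z. z $ 3"]
    by (simp_all add: expand that)
  \<comment> \<open>The x-derivative of \<open>c2(4)\<close> leaves - \<epsilon> d_t X3, as d_x d_t
    X3 = 0. Commuted, it is the y-derivative of d_x d_x X3 = 0.\<close>
  have c_1: "pd 1 ?c p = 0" if p: "p \<in> M" for p
  proof -
    have "- \<epsilon> * pd 1 ?c p = pd 2 (pd 3 (pd 2 ?c)) p"
      by (subst pd_cong[OF _ c2(4)]) (simp_all add: pd_rules p sm c2)
    also have "\<dots> = pd 3 (\<lambda>_. 0) p"
      by (subst pd_commute, simp_all add: smooth_rules sm p, rule pd_cong) (simp_all add: smooth_rules sm c2 p)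
    finally show ?thesis
      using \<epsilon> by (simp add: pd_const)
  qed
  have c_2: "pd 2 ?c p = 0" if p: "p \<in> M" for p
  proof -
    have "\<epsilon> * pd 2 ?c p = pd 2 (pd 3 (pd 3 ?c)) p"
      by (subst pd_cong[OF _ c2(6)]) (simp_all add: pd_rules p sm c2)
    also have "\<dots> = pd 3 (\<lambda>_. 0) p"
      by (subst pd_commute, simp_all add: smooth_rules sm p, rule pd_cong) (simp_all add: smooth_rules sm c2 c_1 p)
    finally show ?thesis
      using \<epsilon> by (simp add: pd_const)
  qed
  have b2: "pd 1 (pd 2 ?b) p = 0" "pd 2 (pd 2 ?b) p = 0" "pd 2 (pd 1 ?b) p = 0"
      "pd 3 (pd 2 ?b) p = - \<epsilon> * p $ 2 * pd 1 ?b p" "pd 2 (pd 3 ?b) p = - \<epsilon> * p $ 2 * pd 1 ?b p"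
      "pd 3 (pd 3 ?b) p = \<epsilon> * p $ 2 * pd 2 ?b p - \<epsilon> * ?b p - 2 * \<epsilon> * p $ 2 * pd 3 ?c p"
    if "p \<in> M" for p
    using eq[OF that, where u = "axis 1 1" and v = "axis 2 1", THEN arg_cong, where f = "\<lambda>z. z $ 2"] eq[OF that, where u = "axis 2 1" and v = "axis 2 1", THEN arg_cong, where f = "\<lambda>z. z $ 2"] eq[OF that, where u = "axis 2 1" and v = "axis 1 1", THEN arg_cong, where f = "\<lambda>z. z $ 2"] eq[OF that, where u = "axis 3 1" and v = "axis 2 1", THEN arg_cong, where f = "\<lambda>z. z $ 2"]
      eq[OF that, where u = "axis 2 1" and v = "axis 3 1", THEN arg_cong, where f = "\<lambda>z. z $ 2"] eq[OF that, where u = "axis 3 1" and v = "axis 3 1", THEN arg_cong, where f = "\<lambda>z. z $ 2"]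
    by (simp_all add: expand that c_1 c_2)
  have b_1: "pd 1 ?b p = 0" if p: "p \<in> M" for p
  proof -
    have "- \<epsilon> * pd 1 ?b p = pd 2 (pd 3 (pd 2 ?b)) p"
      by (subst pd_cong[OF _ b2(4)]) (simp_all add: pd_rules p sm b2)
    also have "\<dots> = pd 3 (\<lambda>_. 0) p"
      by (subst pd_commute, simp_all add: smooth_rules sm p, rule pd_cong) (simp_all add: smooth_rules sm b2 p)
    finally show ?thesis
      using \<epsilon> by (simp add: pd_const)
  qed
  \<comment> \<open>In the x-derivative of \<open>b2(6)\<close> the two X2 contributions cancel
    because d_x d_x X2 = 0, and only X3 is left.\<close>
  have c_3: "pd 3 ?c p = 0" if p: "p \<in> M" for p
  proof -
    have "- 2 * \<epsilon> * pd 3 ?c p = pd 2 (pd 3 (pd 3 ?b)) p"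
      by (subst pd_cong[OF _ b2(6)]) (simp_all add: pd_rules p sm b2 c2 c_1)
    also have "\<dots> = pd 3 (\<lambda>_. 0) p"
      by (subst pd_commute, simp_all add: smooth_rules sm p, rule pd_cong) (simp_all add: smooth_rules sm b2 b_1 p)
    finally show ?thesis
      using \<epsilon> by (simp add: pd_const)
  qed
  have a2: "pd 2 (pd 1 ?a) p = 0" "pd 2 (pd 2 ?a) p = 0"
      "pd 3 (pd 2 ?a) p = \<epsilon> * ?b p - \<epsilon> * p $ 2 * pd 1 ?a p + \<epsilon> * p $ 2 * pd 2 ?b p"
      "pd 2 (pd 3 ?a) p = \<epsilon> * ?b p - \<epsilon> * p $ 2 * pd 1 ?a p + \<epsilon> * p $ 2 * pd 2 ?b p"
      "pd 3 (pd 3 ?a) p = \<epsilon> * p $ 2 * pd 2 ?a p + 2 * \<epsilon> * p $ 2 * pd 3 ?b p"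
    if "p \<in> M" for p
    using eq[OF that, where u = "axis 2 1" and v = "axis 1 1", THEN arg_cong, where f = "\<lambda>z. z $ 1"] eq[OF that, where u = "axis 2 1" and v = "axis 2 1", THEN arg_cong, where f = "\<lambda>z. z $ 1"] eq[OF that, where u = "axis 3 1" and v = "axis 2 1", THEN arg_cong, where f = "\<lambda>z. z $ 1"]
      eq[OF that, where u = "axis 2 1" and v = "axis 3 1", THEN arg_cong, where f = "\<lambda>z. z $ 1"] eq[OF that, where u = "axis 3 1" and v = "axis 3 1", THEN arg_cong, where f = "\<lambda>z. z $ 1"]
    by (simp_all add: expand that c_1 c_2 c_3 b_1)
  have a_1: "pd 1 ?a p = 2 * pd 2 ?b p" if p: "p \<in> M" for p
  proof -
    have "2 * \<epsilon> * pd 2 ?b p - \<epsilon> * pd 1 ?a p = pd 2 (pd 3 (pd 2 ?a)) p"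
      by (subst pd_cong[OF _ a2(3)]) (simp_all add: pd_rules p sm b2 a2)
    also have "\<dots> = pd 3 (\<lambda>_. 0) p"
      by (subst pd_commute, simp_all add: smooth_rules sm p, rule pd_cong) (simp_all add: smooth_rules sm a2 p)
    finally show ?thesis
      using \<epsilon> by (simp add: pd_const)
  qed
  \<comment> \<open>Unlike before, the commuted side does not vanish: it contributes \<epsilon> d_y
    X2 and lowers the coefficient of d_y X2 from 2 to 1.\<close>
  have a_2: "pd 2 ?a p = - pd 3 ?b p" if p: "p \<in> M" for p
  proof -
    have "\<epsilon> * pd 2 ?a p + 2 * \<epsilon> * pd 3 ?b p = pd 2 (pd 3 (pd 3 ?a)) p"
      by (subst pd_cong[OF _ a2(5)]) (simp_all add: pd_rules p sm b2 a2 b_1)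
    also have "\<dots> = pd 3 (\<lambda>q. \<epsilon> * ?b q - \<epsilon> * q $ 2 * pd 2 ?b q) p"
      by (subst pd_commute, simp_all add: smooth_rules sm p, rule pd_cong) (simp_all add: smooth_rules sm a2 a_1 p)
    also have "\<dots> = \<epsilon> * pd 3 ?b p"
      by (simp add: pd_rules sm p b2 b_1)
    finally have "\<epsilon> * (pd 2 ?a p + pd 3 ?b p) = 0"
      by (simp add: algebra_simps)
    then show ?thesis
      using \<epsilon> by simp
  qed
  show ?thesis
    unfolding affine_system_def
    by (simp add: c_1 c_2 c_3 b_1 b2 a_1 a_2 a2 algebra_simps)
qed

text \<open>The first-order equations are differentiated once and the mixed derivatives of X1 and X2
  compared until X3 is seen to be constant. The last two conclusions are the part of the homothetic
  condition that the affine system does not contain.\<close>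

lemma homothetic_equation_imp_system:
  assumes \<epsilon>: "\<epsilon> \<noteq> 0" and X: "smooth_on M X"
    and eq: "\<And>p u v. p \<in> M \<Longrightarrow> cw_product \<epsilon> p (frechet_derivative X (at p) u) v
      + cw_product \<epsilon> p u (frechet_derivative X (at p) v)
      - 2 * \<epsilon> * p $ 2 * X p $ 2 * (u $ 3 * v $ 3) = \<eta> * cw_product \<epsilon> p u v"
  shows "affine_system \<epsilon> (\<lambda>p. X p $ 1) (\<lambda>p. X p $ 2) (\<lambda>p. X p $ 3)"
    and "\<And>p. p \<in> M \<Longrightarrow> pd 1 (\<lambda>p. X p $ 1) p = \<eta>"
    and "\<And>p. p \<in> M \<Longrightarrow> pd 3 (\<lambda>p. X p $ 1) p = \<epsilon> * p $ 2 * (X p $ 2 - p $ 2 * \<eta> / 2)"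
proof -
  let ?a = "\<lambda>p. X p $ 1" and ?b = "\<lambda>p. X p $ 2" and ?c = "\<lambda>p. X p $ 3"
  have sm: "smooth_on M ?a" "smooth_on M ?b" "smooth_on M ?c"
    by (intro smooth_rules X)+
  note expand = frechet_derivative_nth[OF X] cw_product_def axis_def
  have c_1: "pd 1 ?c p = 0" if "p \<in> M" for p
    using eq[OF that, where u = "axis 1 1" and v = "axis 1 1"] by (simp add: expand that)
  have b_1: "pd 1 ?b p = - pd 2 ?c p" and a_1: "pd 1 ?a p = \<eta> - pd 3 ?c p" and b_2: "pd 2 ?b p = \<eta> / 2"
    and a_2: "pd 2 ?a p = \<epsilon> * (p $ 2)\<^sup>2 * pd 2 ?c p - pd 3 ?b p"
    and a_3: "pd 3 ?a p = \<epsilon> * (p $ 2)\<^sup>2 * pd 3 ?c p + \<epsilon> * p $ 2 * ?b p - \<eta> * \<epsilon> * (p $ 2)\<^sup>2 / 2"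
    if "p \<in> M" for p
    using eq[OF that, where u = "axis 1 1" and v = "axis 2 1"] eq[OF that, where u = "axis 1 1" and v = "axis 3 1"] eq[OF that, where u = "axis 2 1" and v = "axis 2 1"] eq[OF that, where u = "axis 2 1" and v = "axis 3 1"]
      eq[OF that, where u = "axis 3 1" and v = "axis 3 1"]
    by (simp_all add: expand that c_1)
  have D: "pd i (pd 1 ?c) p = 0" "pd i (pd 1 ?b) p = - pd i (pd 2 ?c) p"
      "pd i (pd 1 ?a) p = - pd i (pd 3 ?c) p" "pd i (pd 2 ?b) p = 0"
      "pd i (pd 2 ?a) p = pd i (\<lambda>p. \<epsilon> * (p $ 2)\<^sup>2 * pd 2 ?c p - pd 3 ?b p) p"
      "pd i (pd 3 ?a) p =
        pd i (\<lambda>p. \<epsilon> * (p $ 2)\<^sup>2 * pd 3 ?c p + \<epsilon> * p $ 2 * ?b p - \<eta> * \<epsilon> * (p $ 2)\<^sup>2 / 2) p"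
    if p: "p \<in> M" for p i
    using pd_cong[where i = i, OF _ c_1 p] pd_cong[where i = i, OF _ b_1 p] pd_cong[where i = i, OF _ a_1 p] pd_cong[where i = i, OF _ b_2 p]
      pd_cong[where i = i, OF _ a_2 p] pd_cong[where i = i, OF _ a_3 p]
    by (simp_all add: pd_rules sm p)
  have cs: "pd 1 (pd i ?c) p = 0" if p: "p \<in> M" for i p
    using D(1)[OF p, of i] by (simp add: pd_commute[OF sm(3) p])
  have c22: "pd 2 (pd 2 ?c) p = 0" if p: "p \<in> M" for p
    using D(2)[OF p, of 2] D(4)[OF p, of 1] pd_commute[OF sm(2) p, of 1 2] by simp
  \<comment> \<open>Commuting the mixed derivatives of X1 and inserting d_t X2 = - d_x X3 shows that
    d_x d_y X3 equals its own negative.\<close>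
  have c23: "pd 2 (pd 3 ?c) p = 0" if p: "p \<in> M" for p
  proof -
    have "pd 1 (pd 2 ?a) p = - pd 1 (pd 3 ?b) p"
      by (simp add: D(5)[OF p]) (simp add: pd_rules sm p cs)
    then show ?thesis
      using D(2)[OF p, of 3] D(3)[OF p, of 2] pd_commute[OF sm(1) p, of 1 2]
        pd_commute[OF sm(2) p, of 1 3] pd_commute[OF sm(3) p, of 2 3] by simp
  qed
  have c33: "pd 3 (pd 3 ?c) p = \<epsilon> * p $ 2 * pd 2 ?c p" if p: "p \<in> M" for p
  proof -
    have "pd 1 (pd 3 ?a) p = \<epsilon> * p $ 2 * pd 1 ?b p"
      by (simp add: D(6)[OF p]) (simp add: pd_rules sm p cs)
    then show ?thesis
      using D(3)[OF p, of 3] pd_commute[OF sm(1) p, of 1 3] b_1[OF p] by simp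
  qed
  have c_2: "pd 2 ?c p = 0" if p: "p \<in> M" for p
  proof -
    have "\<epsilon> * pd 2 ?c p = pd 2 (pd 3 (pd 3 ?c)) p"
      by (subst pd_cong[OF _ c33]) (simp_all add: pd_rules p sm c22)
    also have "\<dots> = pd 3 (\<lambda>_. 0) p"
      by (subst pd_commute, simp_all add: smooth_rules sm p, rule pd_cong) (simp_all add: smooth_rules sm c23 p)
    finally show ?thesis
      using \<epsilon> by (simp add: pd_const)
  qed
  \<comment> \<open>The compatibility of the prescribed d_x X1 and d_y X1 is a second-order equation
    for X2: the oscillator equation with a perturbation in d_y X3.\<close>
  have b33: "pd 3 (pd 3 ?b) p = \<epsilon> * p $ 2 * \<eta> / 2 - \<epsilon> * ?b p - 2 * \<epsilon> * p $ 2 * pd 3 ?c p"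
    if p: "p \<in> M" for p
  proof -
    have "pd 2 (pd 3 ?a) p = 2 * \<epsilon> * p $ 2 * pd 3 ?c p + \<epsilon> * ?b p - \<epsilon> * p $ 2 * \<eta> / 2"
      by (simp add: D(6)[OF p]) (simp add: pd_rules sm p c23 b_2 field_simps)
    moreover have "pd 3 (pd 2 ?a) p = - pd 3 (pd 3 ?b) p"
      using pd_cong[where i = 3, OF _ a_2 p] pd_commute[OF sm(3) p, of 3 2] c23[OF p]
      by (simp add: pd_rules sm p)
    ultimately show ?thesis
      using pd_commute[OF sm(1) p, of 2 3] by simp
  qed
  have c_3: "pd 3 ?c p = 0" if p: "p \<in> M" for p
  proof -
    have "- 2 * \<epsilon> * pd 3 ?c p = pd 2 (pd 3 (pd 3 ?b)) p"
      by (subst pd_cong[OF _ b33]) (simp_all add: pd_rules p sm c23 b_2)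
    also have "\<dots> = pd 3 (\<lambda>_. 0) p"
      by (subst pd_commute, simp_all add: smooth_rules sm p, rule pd_cong)
        (simp_all add: smooth_rules sm D(4) p pd_commute[OF sm(2), of _ 2 3])
    finally show ?thesis
      using \<epsilon> by (simp add: pd_const)
  qed
  show "\<And>p. p \<in> M \<Longrightarrow> pd 1 ?a p = \<eta>"
    by (simp add: a_1 c_3)
  show a_3': "\<And>p. p \<in> M \<Longrightarrow> pd 3 ?a p = \<epsilon> * p $ 2 * (?b p - p $ 2 * \<eta> / 2)"
    by (simp add: a_3 c_3 algebra_simps power2_eq_square)
  have "pd 3 (pd 3 ?a) p = \<epsilon> * p $ 2 * pd 3 ?b p" if p: "p \<in> M" for p
    using pd_cong[where i = 3, OF _ a_3' p] by (simp add: pd_rules sm p)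
  then show "affine_system \<epsilon> ?a ?b ?c"
    unfolding affine_system_def
    by (simp add: c_1 c_2 c_3 b_1 b_2 b33 a_1 a_2 D(4) algebra_simps)
qed

lemma affine_system_solution:
  assumes \<epsilon>: "\<epsilon> \<in> {1, -1}" and sm: "smooth_on M a" "smooth_on M b" "smooth_on M c"
    and sys: "affine_system \<epsilon> a b c"
  shows "\<exists>c1 c2 c3 c4 c5 c6. \<forall>p\<in>M.
    a p = cw_S \<epsilon> c1 c2 (p $ 3) * p $ 2 + c3 + c5 * p $ 1 + c6 * p $ 3 \<and>
    b p = cw_T \<epsilon> c1 c2 (p $ 3) + c5 / 2 * p $ 2 \<and> c p = c4"
proof -
  have S: "pd 1 c p = 0" "pd 2 c p = 0" "pd 3 c p = 0"
     "pd 1 b p = 0" "pd 1 (pd 2 b) p = 0" "pd 2 (pd 2 b) p = 0" "pd 3 (pd 2 b) p = 0"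
     "pd 3 (pd 3 b) p = - \<epsilon> * (b p - p $ 2 * pd 2 b p)"
     "pd 1 a p = 2 * pd 2 b p" "pd 2 a p = - pd 3 b p"
     "pd 3 (pd 3 a) p = \<epsilon> * p $ 2 * pd 3 b p" if "p \<in> M" for p
    using sys that unfolding affine_system_def by blast+
  obtain c4 where c4: "\<And>p. p \<in> M \<Longrightarrow> c p = c4"
    using constant_if_pd_zero[OF sm(3) S(1-3)] by blast
  obtain \<beta> where \<beta>: "\<And>p. p \<in> M \<Longrightarrow> pd 2 b p = \<beta>"
    using constant_if_pd_zero[OF smooth_on_pd[OF sm(2)] S(5-7)] by blast
  define h where "h = (\<lambda>p. b p - \<beta> * p $ 2)"
  have h: "smooth_on M h"
    unfolding h_def by (intro smooth_rules sm)
  have h3: "pd 3 h p = pd 3 b p" if "p \<in> M" for p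
    using that by (simp add: h_def pd_rules sm)
  obtain c1 c2 where T: "\<And>p. p \<in> M \<Longrightarrow> h p = cw_T \<epsilon> c1 c2 (p $ 3) \<and> pd 3 h p = - cw_S \<epsilon> c1 c2 (p $ 3)"
  proof -
    have "pd 1 h p = 0" "pd 2 h p = 0" if "p \<in> M" for p
      using that by (simp_all add: h_def pd_rules sm S \<beta>)
    moreover have "pd 3 (pd 3 h) p = - \<epsilon> * h p" if "p \<in> M" for p
      using that pd_cong[where i = 3, OF _ h3 that] h by (simp add: smooth_rules S \<beta> h_def mult.commute)
    ultimately show ?thesis
      using cw_T_ode[OF \<epsilon> h] that by blast
  qed
  \<comment> \<open>Removing the known t- and x-dependence of X1 leaves a function of y alone. Its
    second derivative vanishes, and its slope is \<open>c6\<close>.\<close>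
  define w where "w = (\<lambda>p. a p + pd 3 b p * p $ 2 - 2 * \<beta> * p $ 1)"
  have w: "smooth_on M w"
    unfolding w_def by (intro smooth_rules sm)
  have b3: "pd 1 (pd 3 b) p = 0" "pd 2 (pd 3 b) p = 0" if p: "p \<in> M" for p
    using pd_commute[OF sm(2) p, of _ 3] pd_cong[where i = 3, OF _ S(4) p] S(7)[OF p]
    by (simp_all add: smooth_rules sm pd_const)
  have w1: "pd 1 w p = 0" and w2: "pd 2 w p = 0" and w3: "pd 3 w p = pd 3 a p - \<epsilon> * p $ 2 * h p"
    if "p \<in> M" for p
    using that by (simp_all add: w_def pd_rules sm S \<beta> b3 h_def algebra_simps)
  have w33: "pd 3 (pd 3 w) p = 0" if p: "p \<in> M" for p
    using pd_cong[where i = 3, OF _ w3 p] by (simp add: pd_rules w h sm p h3 S)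
  have w13: "pd 1 (pd 3 w) p = 0" "pd 2 (pd 3 w) p = 0" if p: "p \<in> M" for p
    using pd_commute[OF w p, of _ 3] pd_cong[where i = 3, OF _ w1 p] pd_cong[where i = 3, OF _ w2 p]
    by (simp_all add: smooth_rules w pd_const)
  obtain c6 where c6: "\<And>p. p \<in> M \<Longrightarrow> pd 3 w p = c6"
    using constant_if_pd_zero[OF smooth_on_pd[OF w] w13 w33] by blast
  obtain c3 where c3: "\<And>p. p \<in> M \<Longrightarrow> w p - c6 * p $ 3 = c3"
  proof -
    have "smooth_on M (\<lambda>p. w p - c6 * p $ 3)"
      by (intro smooth_rules w)
    from constant_if_pd_zero[OF this] that show ?thesis
      by (auto simp: pd_rules w w1 w2 c6)
  qed
  \<comment> \<open>The constant c5 is 2 \<beta>: the slope of X1 in t is twice that of X2 in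
    x.\<close>
  have "a p = cw_S \<epsilon> c1 c2 (p $ 3) * p $ 2 + c3 + (2 * \<beta>) * p $ 1 + c6 * p $ 3 \<and>
    b p = cw_T \<epsilon> c1 c2 (p $ 3) + (2 * \<beta>) / 2 * p $ 2 \<and> c p = c4" if p: "p \<in> M" for p
    using T[OF p, unfolded h3[OF p]] c3[OF p] c4[OF p] by (auto simp: w_def h_def algebra_simps)
  then show ?thesis
    by blast
qed

text \<open>A table of derivatives for both converse directions, and for reading off
  \<open>c5\<close> and \<open>c6\<close> from a homothetic field. The components equal the formulas
  on \<open>M\<close> only, so \<open>pd_eqI\<close> is applied at each order.\<close>

lemma affine_formula_derivatives:
  assumes \<epsilon>: "\<epsilon> \<in> {1, -1}" and sm: "smooth_on M a" "smooth_on M b" "smooth_on M c"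
    and a: "\<And>p. p \<in> M \<Longrightarrow> a p = cw_S \<epsilon> c1 c2 (p $ 3) * p $ 2 + c3 + c5 * p $ 1 + c6 * p $ 3"
    and b: "\<And>p. p \<in> M \<Longrightarrow> b p = cw_T \<epsilon> c1 c2 (p $ 3) + c5 / 2 * p $ 2"
    and c: "\<And>p. p \<in> M \<Longrightarrow> c p = c4"
    and p: "p \<in> M"
  shows "pd i c p = 0" "pd 1 b p = 0" "pd 2 b p = c5 / 2" "pd 3 b p = - cw_S \<epsilon> c1 c2 (p $ 3)"
    "pd 1 a p = c5" "pd 2 a p = cw_S \<epsilon> c1 c2 (p $ 3)" "pd 3 a p = \<epsilon> * cw_T \<epsilon> c1 c2 (p $ 3) * p $ 2 + c6"
    "pd i (pd j c) p = 0" "pd i (pd 1 b) p = 0" "pd i (pd 2 b) p = 0" "pd i (pd 1 a) p = 0"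
    "pd 1 (pd 3 b) p = 0" "pd 2 (pd 3 b) p = 0" "pd 3 (pd 3 b) p = - (\<epsilon> * cw_T \<epsilon> c1 c2 (p $ 3))"
    "pd 1 (pd 2 a) p = 0" "pd 2 (pd 2 a) p = 0" "pd 3 (pd 2 a) p = \<epsilon> * cw_T \<epsilon> c1 c2 (p $ 3)"
    "pd 1 (pd 3 a) p = 0" "pd 2 (pd 3 a) p = \<epsilon> * cw_T \<epsilon> c1 c2 (p $ 3)"
    "pd 3 (pd 3 a) p = - (\<epsilon> * cw_S \<epsilon> c1 c2 (p $ 3) * p $ 2)"
proof -
  note der = axis_def algebra_simps
  note intros = DERIV_cong[OF DERIV_cw_S[OF _ \<epsilon>]] derivative_eq_intros
  have c': "pd i c p = 0" if "p \<in> M" for i p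
    by (rule pd_eqI[OF sm(3) that c]) auto
  have b1: "pd 1 b p = 0" and b2: "pd 2 b p = c5 / 2" and b3: "pd 3 b p = - cw_S \<epsilon> c1 c2 (p $ 3)"
    if "p \<in> M" for p
    by (rule pd_eqI[OF sm(2) that b], assumption, (auto intro!: derivative_eq_intros simp: der)[1])+
  have a1: "pd 1 a p = c5" and a2: "pd 2 a p = cw_S \<epsilon> c1 c2 (p $ 3)"
    and a3: "pd 3 a p = \<epsilon> * cw_T \<epsilon> c1 c2 (p $ 3) * p $ 2 + c6" if "p \<in> M" for p
    by (rule pd_eqI[OF sm(1) that a], assumption, (auto intro!: intros simp: der)[1])+
  show "pd i c p = 0" "pd 1 b p = 0" "pd 2 b p = c5 / 2" "pd 3 b p = - cw_S \<epsilon> c1 c2 (p $ 3)"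
    "pd 1 a p = c5" "pd 2 a p = cw_S \<epsilon> c1 c2 (p $ 3)" "pd 3 a p = \<epsilon> * cw_T \<epsilon> c1 c2 (p $ 3) * p $ 2 + c6"
    by (fact c'[OF p] b1[OF p] b2[OF p] b3[OF p] a1[OF p] a2[OF p] a3[OF p])+
  show "pd i (pd j c) p = 0" "pd i (pd 1 b) p = 0" "pd i (pd 2 b) p = 0" "pd i (pd 1 a) p = 0"
    using pd_cong[where i = i, OF _ c'[where i = j] p] pd_cong[where i = i, OF _ b1 p] pd_cong[where i = i, OF _ b2 p] pd_cong[where i = i, OF _ a1 p]
    by (simp_all add: smooth_rules sm pd_const)
  show "pd 1 (pd 3 b) p = 0" "pd 2 (pd 3 b) p = 0" "pd 3 (pd 3 b) p = - (\<epsilon> * cw_T \<epsilon> c1 c2 (p $ 3))"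
    by (rule pd_eqI[OF smooth_on_pd[OF sm(2)] p b3], assumption,
        (auto intro!: intros simp: der)[1])+
  show "pd 1 (pd 2 a) p = 0" "pd 2 (pd 2 a) p = 0" "pd 3 (pd 2 a) p = \<epsilon> * cw_T \<epsilon> c1 c2 (p $ 3)"
    by (rule pd_eqI[OF smooth_on_pd[OF sm(1)] p a2], assumption,
        (auto intro!: intros simp: der)[1])+
  show "pd 1 (pd 3 a) p = 0" "pd 2 (pd 3 a) p = \<epsilon> * cw_T \<epsilon> c1 c2 (p $ 3)"
    "pd 3 (pd 3 a) p = - (\<epsilon> * cw_S \<epsilon> c1 c2 (p $ 3) * p $ 2)"
    by (rule pd_eqI[OF smooth_on_pd[OF sm(1)] p a3], assumption,
        (auto intro!: intros simp: der)[1])+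
qed

lemma affine_field_cw:
  assumes \<epsilon>: "\<epsilon> \<in> {1, -1}" and X: "smooth_on M X"
  shows "affine_field M (cw_metric \<epsilon>) X \<longleftrightarrow> (\<exists>c1 c2 c3 c4 c5 c6. \<forall>p\<in>M. X p = vector [
    cw_S \<epsilon> c1 c2 (p $ 3) * p $ 2 + c3 + c5 * p $ 1 + c6 * p $ 3,
    cw_T \<epsilon> c1 c2 (p $ 3) + c5 / 2 * p $ 2,
    c4])"
proof
  have "\<epsilon> \<noteq> 0"
    using \<epsilon> by auto
  assume "affine_field M (cw_metric \<epsilon>) X"
  then have "affine_system \<epsilon> (\<lambda>p. X p $ 1) (\<lambda>p. X p $ 2) (\<lambda>p. X p $ 3)"
    unfolding affine_field_cw_iff[OF open_M X]
    by (intro affine_equation_imp_system[OF \<open>\<epsilon> \<noteq> 0\<close> X]) blast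
  from affine_system_solution[OF \<epsilon> _ _ _ this]
  show "\<exists>c1 c2 c3 c4 c5 c6. \<forall>p\<in>M. X p = vector [
    cw_S \<epsilon> c1 c2 (p $ 3) * p $ 2 + c3 + c5 * p $ 1 + c6 * p $ 3,
    cw_T \<epsilon> c1 c2 (p $ 3) + c5 / 2 * p $ 2,
    c4]"
    by (simp add: smooth_rules X vec_eq_iff forall_3)
next
  assume "\<exists>c1 c2 c3 c4 c5 c6. \<forall>p\<in>M. X p = vector [
    cw_S \<epsilon> c1 c2 (p $ 3) * p $ 2 + c3 + c5 * p $ 1 + c6 * p $ 3,
    cw_T \<epsilon> c1 c2 (p $ 3) + c5 / 2 * p $ 2,
    c4]"
  then obtain c1 c2 c3 c4 c5 c6 where f:
    "\<And>p. p \<in> M \<Longrightarrow> X p $ 1 = cw_S \<epsilon> c1 c2 (p $ 3) * p $ 2 + c3 + c5 * p $ 1 + c6 * p $ 3"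
    "\<And>p. p \<in> M \<Longrightarrow> X p $ 2 = cw_T \<epsilon> c1 c2 (p $ 3) + c5 / 2 * p $ 2"
    "\<And>p. p \<in> M \<Longrightarrow> X p $ 3 = c4"
    by (auto simp: vec_eq_iff forall_3)
  have sm: "smooth_on M (\<lambda>p. X p $ i)" for i
    by (intro smooth_rules X)
  show "affine_field M (cw_metric \<epsilon>) X"
    unfolding affine_field_cw_iff[OF open_M X]
  proof (intro ballI allI)
    fix p u v assume p: "p \<in> M"
    note ders = affine_formula_derivatives[OF \<epsilon> sm sm sm f p]
    show "frechet_derivative (\<lambda>q. frechet_derivative X (at q) v) (at p) u
      + cw_gamma \<epsilon> (X p) u v + cw_gamma \<epsilon> p (frechet_derivative X (at p) u) v
      + cw_gamma \<epsilon> p u (frechet_derivative X (at p) v)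
      - frechet_derivative X (at p) (cw_gamma \<epsilon> p u v) = 0"
      by (simp add: vec_eq_iff forall_3 frechet_derivative_nth[OF X p] second_frechet_derivative_nth[OF X p]
          sum_3 cw_gamma_def ders f(2,3)[OF p])
        (simp add: algebra_simps)
  qed
qed

text \<open>\<open>\<eta>\<close> is fixed on both sides, so that one equivalence serves Killing
  fields at \<open>\<eta> = 0\<close> and homothetic fields by quantifying over
  \<open>\<eta>\<close>.\<close>

lemma homothetic_equation_cw:
  assumes \<epsilon>: "\<epsilon> \<in> {1, -1}" and X: "smooth_on M X" and "M \<noteq> {}"
  shows "(\<forall>Y Z. smooth_on M Y \<longrightarrow> smooth_on M Z \<longrightarrow>
      (\<forall>p\<in>M. lie_bilinear X (metric_tensor (cw_metric \<epsilon>)) Y Z p = \<eta> * metric_tensor (cw_metric \<epsilon>) Y Z p))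
    \<longleftrightarrow> (\<exists>c1 c2 c3 c4. \<forall>p\<in>M. X p = vector [
    cw_S \<epsilon> c1 c2 (p $ 3) * p $ 2 + c3 + \<eta> * p $ 1,
    cw_T \<epsilon> c1 c2 (p $ 3) + \<eta> / 2 * p $ 2,
    c4])" (is "?L \<longleftrightarrow> ?R")
proof
  have "\<epsilon> \<noteq> 0"
    using \<epsilon> by auto
  have sm: "smooth_on M (\<lambda>p. X p $ i)" for i
    by (intro smooth_rules X)
  assume ?L
  then have eq: "\<And>p u v. p \<in> M \<Longrightarrow> cw_product \<epsilon> p (frechet_derivative X (at p) u) v
      + cw_product \<epsilon> p u (frechet_derivative X (at p) v)
      - 2 * \<epsilon> * p $ 2 * X p $ 2 * (u $ 3 * v $ 3) = \<eta> * cw_product \<epsilon> p u v"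
    unfolding homothetic_equation_cw_iff[OF open_M X] by blast
  note sys = homothetic_equation_imp_system[OF \<open>\<epsilon> \<noteq> 0\<close> X eq]
  obtain c1 c2 c3 c4 c5 c6 where f:
    "\<And>p. p \<in> M \<Longrightarrow> X p $ 1 = cw_S \<epsilon> c1 c2 (p $ 3) * p $ 2 + c3 + c5 * p $ 1 + c6 * p $ 3"
    "\<And>p. p \<in> M \<Longrightarrow> X p $ 2 = cw_T \<epsilon> c1 c2 (p $ 3) + c5 / 2 * p $ 2"
    "\<And>p. p \<in> M \<Longrightarrow> X p $ 3 = c4"
    using affine_system_solution[OF \<epsilon> sm sm sm sys(1)] by blast
  \<comment> \<open>One point is enough: the prescribed values of d_t X1 and d_y X1 there force
    \<open>c5 = \<eta>\<close> and \<open>c6 = 0\<close>.\<close>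
  obtain p where p: "p \<in> M"
    using \<open>M \<noteq> {}\<close> by blast
  note ders = affine_formula_derivatives[OF \<epsilon> sm sm sm f p]
  have "c5 = \<eta>"
    using ders(5) sys(2)[OF _ p] by simp
  moreover have "c6 = 0"
    using ders(7) sys(3)[OF _ p] f(2)[OF p] \<open>c5 = \<eta>\<close> by (simp add: algebra_simps)
  ultimately show ?R
    using f by (intro exI[of _ c1] exI[of _ c2] exI[of _ c3] exI[of _ c4]) (simp add: vec_eq_iff forall_3)
next
  assume ?R
  \<comment> \<open>The summand \<open>0 * p $ 3\<close> gives the formula the affine shape with
    \<open>c6 = 0\<close>, to which the table of derivatives applies.\<close>
  then obtain c1 c2 c3 c4 where f:
    "\<And>p. p \<in> M \<Longrightarrow> X p $ 1 = cw_S \<epsilon> c1 c2 (p $ 3) * p $ 2 + c3 + \<eta> * p $ 1 + 0 * p $ 3"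
    "\<And>p. p \<in> M \<Longrightarrow> X p $ 2 = cw_T \<epsilon> c1 c2 (p $ 3) + \<eta> / 2 * p $ 2"
    "\<And>p. p \<in> M \<Longrightarrow> X p $ 3 = c4"
    by (auto simp: vec_eq_iff forall_3)
  have sm: "smooth_on M (\<lambda>p. X p $ i)" for i
    by (intro smooth_rules X)
  show ?L
    unfolding homothetic_equation_cw_iff[OF open_M X]
  proof (intro ballI allI)
    fix p u v assume p: "p \<in> M"
    show "cw_product \<epsilon> p (frechet_derivative X (at p) u) v
      + cw_product \<epsilon> p u (frechet_derivative X (at p) v)
      - 2 * \<epsilon> * p $ 2 * X p $ 2 * (u $ 3 * v $ 3) = \<eta> * cw_product \<epsilon> p u v"
      by (simp add: frechet_derivative_nth[OF X p] cw_product_def affine_formula_derivatives[OF \<epsilon> sm sm sm f p]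
          f(2)[OF p]) (simp add: algebra_simps power2_eq_square)
  qed
qed

lemma ricci_collineation_cw:
  assumes \<epsilon>: "\<epsilon> \<noteq> 0" and X: "smooth_on M X"
  shows "ricci_collineation M (cw_metric \<epsilon>) X \<longleftrightarrow> (\<exists>c1. \<forall>p\<in>M. X p $ 3 = c1)"
proof
  have sm: "smooth_on M (\<lambda>p. X p $ 3)"
    by (intro smooth_rules X)
  assume "ricci_collineation M (cw_metric \<epsilon>) X"
  then have eq: "frechet_derivative X (at p) u $ 3 * v $ 3 + u $ 3 * frechet_derivative X (at p) v $ 3 = 0"
    if "p \<in> M" for p u v
    using that unfolding ricci_collineation_cw_iff[OF open_M X \<epsilon>] by blast
  \<comment> \<open>Pairing a coordinate direction with the y direction isolates one derivative of
    X3, doubled when both are the y direction.\<close>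
  have "pd i (\<lambda>p. X p $ 3) p = 0" if "p \<in> M" for i p
    using eq[OF that, of "axis i 1" "axis 3 1"] frechet_derivative_linear[OF bounded_linear_vec_nth[of 3] X that, of "axis i 1"]
    by (cases "i = 3") (auto simp: pd_def axis_def)
  then show "\<exists>c1. \<forall>p\<in>M. X p $ 3 = c1"
    by (intro constant_if_pd_zero[OF sm]) auto
next
  have sm: "smooth_on M (\<lambda>p. X p $ 3)"
    by (intro smooth_rules X)
  assume "\<exists>c1. \<forall>p\<in>M. X p $ 3 = c1"
  then obtain c1 where c1: "\<And>p. p \<in> M \<Longrightarrow> X p $ 3 = c1"
    by blast
  have "pd i (\<lambda>p. X p $ 3) p = 0" if "p \<in> M" for i p
    using pd_cong[OF sm c1 that] by (simp add: pd_const)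
  then show "ricci_collineation M (cw_metric \<epsilon>) X"
    unfolding ricci_collineation_cw_iff[OF open_M X \<epsilon>]
    by (simp add: frechet_derivative_nth[OF X])
qed

lemma curvature_collineation_cw_system:
  assumes \<epsilon>: "\<epsilon> \<noteq> 0" and X: "smooth_on M X"
  shows "curvature_collineation M (cw_metric \<epsilon>) X \<longleftrightarrow> (\<forall>p\<in>M.
    pd 1 (\<lambda>p. X p $ 3) p = 0 \<and> pd 2 (\<lambda>p. X p $ 3) p = 0 \<and> pd 3 (\<lambda>p. X p $ 3) p = 0 \<and>
    pd 1 (\<lambda>p. X p $ 2) p = 0 \<and> pd 1 (\<lambda>p. X p $ 1) p = 2 * pd 2 (\<lambda>p. X p $ 2) p \<and>
    pd 2 (\<lambda>p. X p $ 1) p = - pd 3 (\<lambda>p. X p $ 2) p)"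
    (is "_ \<longleftrightarrow> ?R")
proof
  assume "curvature_collineation M (cw_metric \<epsilon>) X"
  then have eq: "cw_curvature \<epsilon> (frechet_derivative X (at p) u) v w
      + cw_curvature \<epsilon> u (frechet_derivative X (at p) v) w
      + cw_curvature \<epsilon> u v (frechet_derivative X (at p) w)
      - frechet_derivative X (at p) (cw_curvature \<epsilon> u v w) = 0" if "p \<in> M" for p u v w
    using that unfolding curvature_collineation_cw_iff[OF open_M X] by blast
  show ?R
  proof
    fix p assume p: "p \<in> M"
    note comp = eq[OF p, unfolded vec_eq_iff forall_3]
    show "pd 1 (\<lambda>p. X p $ 3) p = 0 \<and> pd 2 (\<lambda>p. X p $ 3) p = 0 \<and> pd 3 (\<lambda>p. X p $ 3) p = 0 \<and>
      pd 1 (\<lambda>p. X p $ 2) p = 0 \<and> pd 1 (\<lambda>p. X p $ 1) p = 2 * pd 2 (\<lambda>p. X p $ 2) p \<and>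
      pd 2 (\<lambda>p. X p $ 1) p = - pd 3 (\<lambda>p. X p $ 2) p"
      \<comment> \<open>With arguments among the coordinate fields, (t,x,y) gives d_t X3 = 0 and
        (t,y,y) gives d_t X2 = 0; (x,y,y) gives d_x X3 = d_y X3 = 0 and d_x X1 = - d_y X2; (x,y,x)
        gives the equation for d_t X1.\<close>
      using \<epsilon> comp[of "axis 1 1" "axis 2 1" "axis 3 1"] comp[of "axis 1 1" "axis 3 1" "axis 3 1"]
        comp[of "axis 2 1" "axis 3 1" "axis 3 1"] comp[of "axis 2 1" "axis 3 1" "axis 2 1"]
      by (simp add: frechet_derivative_nth[OF X p] cw_curvature_def axis_def)
        (metis minus_mult_right mult_left_cancel)
  qed
next
  assume ?R
  show "curvature_collineation M (cw_metric \<epsilon>) X"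
    unfolding curvature_collineation_cw_iff[OF open_M X]
    using \<open>?R\<close>
    by (simp add: vec_eq_iff forall_3 frechet_derivative_nth[OF X] cw_curvature_def) (simp add: algebra_simps)
qed

end

text \<open>The derivative of the restriction is the restriction of a directional derivative, again
  a smooth function on \<open>S\<close>; hence the induction over all \<open>h\<close>.\<close>

lemma Ck_on_along_line:
  fixes h :: "'a::real_normed_vector \<Rightarrow> real"
  assumes "open K" "\<And>s. s \<in> K \<Longrightarrow> q + s *\<^sub>R u \<in> S" "smooth_on S h"
  shows "Ck_on k K (\<lambda>s. h (q + s *\<^sub>R u))"
  using assms(3)
proof (induction k arbitrary: h)
  case 0
  have "continuous_on K (h \<circ> (\<lambda>s. q + s *\<^sub>R u))"
    using assms(2) by (intro continuous_on_compose continuous_intros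
        continuous_on_subset[OF smooth_on_continuous_on[OF 0]]) auto
  then show ?case
    by (simp add: o_def)
next
  case (Suc k)
  have der: "((\<lambda>s. h (q + s *\<^sub>R u)) has_derivative
      (\<lambda>v. v * frechet_derivative h (at (q + s *\<^sub>R u)) u)) (at s)" if "s \<in> K" for s
    using has_real_derivative_along_line[OF Suc.prems assms(2)[OF that]]
    by (simp add: has_field_derivative_def mult_commute_abs)
  have Ck: "Ck_on k K (\<lambda>s. v * frechet_derivative h (at (q + s *\<^sub>R u)) u)" for v
    by (intro Ck_on_linear[OF bounded_linear_mult_right \<open>open K\<close>] Suc.IH smooth_on_frechet_derivative Suc.prems)
  have "Ck_on k K (\<lambda>s. frechet_derivative (\<lambda>s. h (q + s *\<^sub>R u)) (at s) v)" for v
    by (rule Ck_on_cong[OF \<open>open K\<close> _ Ck[of v]]) (simp add: frechet_derivative_at[OF der, symmetric])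
  with der show ?case
    by (auto intro: differentiableI)
qed

section \<open>Coordinate boxes and functions of y alone\<close>

lemma open_coord_box:
  assumes "open I" "open J" "open K"
  shows "open (coord_box I J K)"
proof -
  have "coord_box I J K = (\<lambda>p. p $ 1) -` I \<inter> (\<lambda>p. p $ 2) -` J \<inter> (\<lambda>p. p $ 3) -` K"
    by (auto simp: coord_box_def)
  then show ?thesis
    by (simp add: open_Int open_vimage assms continuous_intros)
qed

lemma convex_coord_box:
  assumes "convex I" "convex J" "convex K"
  shows "convex (coord_box I J K)"
  using assms unfolding coord_box_def convex_def by simp

lemma ball_coord_box:
  "(\<forall>p\<in>coord_box I J K. P p) \<longleftrightarrow> (\<forall>t\<in>I. \<forall>x\<in>J. \<forall>y\<in>K. P (vector [t, x, y]))"
  unfolding Ball_def forall_vector_3 coord_box_def by auto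

locale coord_box_domain = convex_domain "coord_box I J K" for I J K +
  assumes nonempty: "I \<noteq> {}" "J \<noteq> {}" "K \<noteq> {}" and open_K: "open K"
begin

abbreviation M where "M \<equiv> coord_box I J K"

text \<open>\<open>f\<close> is \<open>h\<close> on a line with t and x frozen. The product shape
  keeps this line in the box over all of \<open>K\<close>, so \<open>f\<close> is smooth on the
  whole interval.\<close>

lemma third_coordinate_function:
  assumes h: "smooth_on M h" and h1: "\<And>p. p \<in> M \<Longrightarrow> pd 1 h p = 0" and h2: "\<And>p. p \<in> M \<Longrightarrow> pd 2 h p = 0"
  shows "\<exists>f. smooth_on K f \<and> (\<forall>p\<in>M. h p = f (p $ 3) \<and> pd 3 h p = deriv f (p $ 3))"
proof -
  obtain t0 x0 where t0: "t0 \<in> I" and x0: "x0 \<in> J"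
    using nonempty by blast
  \<comment> \<open>The third coordinate 0 need not lie in \<open>K\<close>; it makes the parameter
    of the line equal to the y coordinate.\<close>
  define q :: "real ^ 3" where "q = vector [t0, x0, 0]"
  define f where "f = (\<lambda>s. h (q + s *\<^sub>R axis 3 1))"
  have q: "q + s *\<^sub>R axis 3 1 \<in> M" if "s \<in> K" for s
    using that t0 x0 by (simp add: q_def coord_box_def axis_def)
  have "smooth_on K f"
    unfolding f_def smooth_on_def using Ck_on_along_line[OF open_K q h] by blast
  have "h p = f (p $ 3) \<and> pd 3 h p = deriv f (p $ 3)" if p: "p \<in> M" for p
  proof
    have K: "p $ 3 \<in> K"
      using p by (simp add: coord_box_def)
    show "h p = f (p $ 3)"
      unfolding f_def by (rule depends_only_on_third[OF h h1 h2 p q[OF K]]) (simp_all add: q_def)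
    have "pd 1 (pd 3 h) z = 0" "pd 2 (pd 3 h) z = 0" if "z \<in> M" for z
      using pd_commute[OF h that, of _ 3] pd_cong[where i = 3, OF _ h1 that] pd_cong[where i = 3, OF _ h2 that]
      by (simp_all add: smooth_rules h pd_const)
    then have "pd 3 h p = pd 3 h (q + p $ 3 *\<^sub>R axis 3 1)"
      by (intro depends_only_on_third[OF smooth_on_pd[OF h] _ _ p q[OF K]]) (simp_all add: q_def)
    also have "\<dots> = deriv f (p $ 3)"
      unfolding f_def by (rule DERIV_imp_deriv[symmetric], rule has_real_derivative_pd[OF h q[OF K]])
    finally show "pd 3 h p = deriv f (p $ 3)" .
  qed
  then show ?thesis
    using \<open>smooth_on K f\<close> by blast
qed

lemma curvature_collineation_cw:
  assumes \<epsilon>: "\<epsilon> \<noteq> 0" and X: "smooth_on M X"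
  shows "curvature_collineation M (cw_metric \<epsilon>) X \<longleftrightarrow> (\<exists>f1 f2 f3 c1.
    smooth_on K f1 \<and> smooth_on K f2 \<and> smooth_on K f3 \<and>
    (\<forall>p\<in>M. X p = vector [
      2 * f1 (p $ 3) * p $ 1 - 1 / 2 * deriv f1 (p $ 3) * (p $ 2)\<^sup>2 - deriv f2 (p $ 3) * p $ 2 + f3 (p $ 3),
      f1 (p $ 3) * p $ 2 + f2 (p $ 3),
      c1]))" (is "_ \<longleftrightarrow> ?R")
proof
  define a b c where abc: "a = (\<lambda>p. X p $ 1)" "b = (\<lambda>p. X p $ 2)" "c = (\<lambda>p. X p $ 3)"
  have sm: "smooth_on M a" "smooth_on M b" "smooth_on M c"
    unfolding abc by (intro smooth_rules X)+
  assume "curvature_collineation M (cw_metric \<epsilon>) X"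
  then have S: "pd 1 c p = 0" "pd 2 c p = 0" "pd 3 c p = 0" "pd 1 b p = 0" "pd 1 a p = 2 * pd 2 b p"
      "pd 2 a p = - pd 3 b p" if "p \<in> M" for p
    using that unfolding curvature_collineation_cw_system[OF \<epsilon> X] abc by blast+
  obtain c1 where c1: "\<And>p. p \<in> M \<Longrightarrow> c p = c1"
    using constant_if_pd_zero[OF sm(3) S(1-3)] by blast
  have b1: "pd 1 (pd i b) p = 0" if p: "p \<in> M" for i p
    using pd_commute[OF sm(2) p, of 1 i] pd_cong[where i = i, OF _ S(4) p] by (simp add: smooth_rules sm pd_const)
  \<comment> \<open>Commuting d_x and d_t on X1 equates 2 d_x d_x X2 with - d_t d_y X2, which is 0:
    X2 is affine in x.\<close>
  have b22: "pd 2 (pd 2 b) p = 0" if p: "p \<in> M" for p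
  proof -
    have "2 * pd 2 (pd 2 b) p = pd 2 (pd 1 a) p"
      by (subst pd_cong[OF _ S(5) p]) (simp_all add: pd_rules sm p)
    also have "\<dots> = - pd 1 (pd 3 b) p"
      using pd_commute[OF sm(1) p, of 2 1] pd_cong[where i = 1, OF _ S(6) p] by (simp add: pd_rules sm p)
    finally show ?thesis
      using b1[OF p] by simp
  qed
  \<comment> \<open>Slope and intercept of X2 as an affine function of x; both depend on y
    only.\<close>
  define F1 F2 where F12: "F1 = pd 2 b" "F2 = (\<lambda>p. b p - p $ 2 * F1 p)"
  have F1: "smooth_on M F1" and F2: "smooth_on M F2"
    unfolding F12 by (intro smooth_rules sm)+
  have F1_12: "pd 1 F1 p = 0" "pd 2 F1 p = 0" if "p \<in> M" for p
    using that by (simp_all add: F12 b1 b22)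
  have F2_1: "pd 1 F2 p = 0" and F2_2: "pd 2 F2 p = 0" and F2_3: "pd 3 F2 p = pd 3 b p - p $ 2 * pd 3 F1 p"
    if p: "p \<in> M" for p
    by (simp_all add: F12(2) pd_rules F1 sm p S F1_12 F12(1)[symmetric])
  have F3_12: "pd 1 (pd 3 F1) p = 0" "pd 2 (pd 3 F1) p = 0" "pd 1 (pd 3 F2) p = 0" "pd 2 (pd 3 F2) p = 0"
    if p: "p \<in> M" for p
    using pd_commute[OF F1 p, of _ 3] pd_commute[OF F2 p, of _ 3] pd_cong[where i = 3, OF _ F1_12(1) p]
      pd_cong[where i = 3, OF _ F1_12(2) p] pd_cong[where i = 3, OF _ F2_1 p] pd_cong[where i = 3, OF _ F2_2 p]
    by (simp_all add: smooth_rules F1 F2 pd_const)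
  \<comment> \<open>What remains of X1 after integrating d_t X1 = 2 F1 in t and d_x X1 = - (x F1' +
    F2') in x.\<close>
  define F3 where "F3 = (\<lambda>p. a p - 2 * F1 p * p $ 1 + 1 / 2 * pd 3 F1 p * (p $ 2)\<^sup>2 + pd 3 F2 p * p $ 2)"
  have F3: "smooth_on M F3"
    unfolding F3_def by (intro smooth_rules F1 F2 sm)
  have F3_12: "pd 1 F3 p = 0" "pd 2 F3 p = 0" if p: "p \<in> M" for p
    by (simp_all add: F3_def pd_rules F1 F2 sm p S F1_12 F3_12 F2_3 F12(1)[symmetric])
  obtain f1 where f1: "smooth_on K f1" "\<And>p. p \<in> M \<Longrightarrow> F1 p = f1 (p $ 3) \<and> pd 3 F1 p = deriv f1 (p $ 3)"
    using third_coordinate_function[OF F1 F1_12] by blast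
  obtain f2 where f2: "smooth_on K f2" "\<And>p. p \<in> M \<Longrightarrow> F2 p = f2 (p $ 3) \<and> pd 3 F2 p = deriv f2 (p $ 3)"
    using third_coordinate_function[OF F2 F2_1 F2_2] by blast
  obtain f3 where f3: "smooth_on K f3" "\<And>p. p \<in> M \<Longrightarrow> F3 p = f3 (p $ 3)"
    using third_coordinate_function[OF F3 F3_12] by blast
  have "X p = vector [
      2 * f1 (p $ 3) * p $ 1 - 1 / 2 * deriv f1 (p $ 3) * (p $ 2)\<^sup>2 - deriv f2 (p $ 3) * p $ 2 + f3 (p $ 3),
      f1 (p $ 3) * p $ 2 + f2 (p $ 3), c1]" if "p \<in> M" for p
  proof -
    have "a p = 2 * f1 (p $ 3) * p $ 1 - 1 / 2 * deriv f1 (p $ 3) * (p $ 2)\<^sup>2 - deriv f2 (p $ 3) * p $ 2 + f3 (p $ 3)"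
      using f3(2)[OF that] f1(2)[OF that] f2(2)[OF that] unfolding F3_def by (simp add: algebra_simps)
    moreover have "b p = f1 (p $ 3) * p $ 2 + f2 (p $ 3)"
      using f1(2)[OF that] f2(2)[OF that] unfolding F12(2) by (simp add: algebra_simps)
    ultimately show ?thesis
      using c1[OF that] by (simp add: vec_eq_iff forall_3 abc)
  qed
  then show ?R
    using f1(1) f2(1) f3(1) by blast
next
  assume ?R
  then obtain f1 f2 f3 c1 where sf: "smooth_on K f1" "smooth_on K f2" "smooth_on K f3"
    and f: "\<And>p. p \<in> M \<Longrightarrow> X p $ 1 =
      2 * f1 (p $ 3) * p $ 1 - 1 / 2 * deriv f1 (p $ 3) * (p $ 2)\<^sup>2 - deriv f2 (p $ 3) * p $ 2 + f3 (p $ 3)"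
    "\<And>p. p \<in> M \<Longrightarrow> X p $ 2 = f1 (p $ 3) * p $ 2 + f2 (p $ 3)"
    "\<And>p. p \<in> M \<Longrightarrow> X p $ 3 = c1"
    by (auto simp: vec_eq_iff forall_3)
  have sm: "smooth_on M (\<lambda>p. X p $ i)" for i
    by (intro smooth_rules X)
  have D: "((\<lambda>s. g (s0 + s)) has_real_derivative deriv g s0) (at 0)" if "smooth_on K g" "s0 \<in> K" for g s0
  proof -
    have "(g has_real_derivative deriv g s0) (at s0)"
      using differentiableI[OF smooth_on_has_derivative[OF that]]
      by (simp add: DERIV_deriv_iff_real_differentiable)
    then show ?thesis
      using DERIV_shift[of g "deriv g s0" 0 s0] by (simp add: add.commute)
  qed
  show "curvature_collineation M (cw_metric \<epsilon>) X"
    unfolding curvature_collineation_cw_system[OF \<epsilon> X]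
  proof
    fix p assume p: "p \<in> M"
    then have K: "p $ 3 \<in> K"
      by (simp add: coord_box_def)
    have "pd i (\<lambda>p. X p $ 3) p = 0" for i
      by (rule pd_eqI[OF sm p f(3)]) auto
    moreover have "pd 1 (\<lambda>p. X p $ 2) p = 0"
      by (rule pd_eqI[OF sm p f(2)], assumption) (auto intro!: derivative_eq_intros simp: axis_def)
    moreover have "pd 2 (\<lambda>p. X p $ 2) p = f1 (p $ 3)"
      by (rule pd_eqI[OF sm p f(2)], assumption) (auto intro!: derivative_eq_intros simp: axis_def)
    moreover have "pd 3 (\<lambda>p. X p $ 2) p = deriv f1 (p $ 3) * p $ 2 + deriv f2 (p $ 3)"
      by (rule pd_eqI[OF sm p f(2)], assumption)
        (auto intro!: derivative_eq_intros D[OF sf(1) K] D[OF sf(2) K] simp: axis_def)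
    moreover have "pd 1 (\<lambda>p. X p $ 1) p = 2 * f1 (p $ 3)"
      by (rule pd_eqI[OF sm p f(1)], assumption) (auto intro!: derivative_eq_intros simp: axis_def)
    moreover have "pd 2 (\<lambda>p. X p $ 1) p = - (deriv f1 (p $ 3) * p $ 2 + deriv f2 (p $ 3))"
      by (rule pd_eqI[OF sm p f(1)], assumption) (auto intro!: derivative_eq_intros simp: axis_def)
    ultimately show "pd 1 (\<lambda>p. X p $ 3) p = 0 \<and> pd 2 (\<lambda>p. X p $ 3) p = 0 \<and> pd 3 (\<lambda>p. X p $ 3) p = 0 \<and>
      pd 1 (\<lambda>p. X p $ 2) p = 0 \<and> pd 1 (\<lambda>p. X p $ 1) p = 2 * pd 2 (\<lambda>p. X p $ 2) p \<and>
      pd 2 (\<lambda>p. X p $ 1) p = - pd 3 (\<lambda>p. X p $ 2) p"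
      by simp
  qed
qed

end

theorem theorem4p3:
  fixes \<epsilon> :: real and I J K :: "real set" and M :: "(real ^ 3) set" and X :: "3 vfield"
  assumes "\<epsilon> \<in> {1, -1}"
    and "open I" "is_interval I" "I \<noteq> {}"
    and "open J" "is_interval J" "J \<noteq> {}"
    and "open K" "is_interval K" "K \<noteq> {}"
    and "M = coord_box I J K"
    and "smooth_on M X"
  shows
    "(killing_field M (cw_metric \<epsilon>) X \<longleftrightarrow>
       (\<exists>c1 c2 c3 c4. \<forall>t\<in>I. \<forall>x\<in>J. \<forall>y\<in>K.
          X (vector [t, x, y]) = vector [
            cw_S \<epsilon> c1 c2 y * x + c3,
            cw_T \<epsilon> c1 c2 y,
            c4]))
   \<and> (homothetic_field M (cw_metric \<epsilon>) X \<longleftrightarrow>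
       (\<exists>c1 c2 c3 c4 \<eta>. \<forall>t\<in>I. \<forall>x\<in>J. \<forall>y\<in>K.
          X (vector [t, x, y]) = vector [
            cw_S \<epsilon> c1 c2 y * x + c3 + \<eta> * t,
            cw_T \<epsilon> c1 c2 y + \<eta> / 2 * x,
            c4]))
   \<and> (affine_field M (cw_metric \<epsilon>) X \<longleftrightarrow>
       (\<exists>c1 c2 c3 c4 c5 c6. \<forall>t\<in>I. \<forall>x\<in>J. \<forall>y\<in>K.
          X (vector [t, x, y]) = vector [
            cw_S \<epsilon> c1 c2 y * x + c3 + c5 * t + c6 * y,
            cw_T \<epsilon> c1 c2 y + c5 / 2 * x,
            c4]))
   \<and> (ricci_collineation M (cw_metric \<epsilon>) X \<longleftrightarrow>
       (\<exists>c1. \<forall>t\<in>I. \<forall>x\<in>J. \<forall>y\<in>K. X (vector [t, x, y]) $ 3 = c1))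
   \<and> (curvature_collineation M (cw_metric \<epsilon>) X \<longleftrightarrow>
       (\<exists>(f1 :: real \<Rightarrow> real) (f2 :: real \<Rightarrow> real) (f3 :: real \<Rightarrow> real) c1.
          smooth_on K f1 \<and> smooth_on K f2 \<and> smooth_on K f3 \<and>
          (\<forall>t\<in>I. \<forall>x\<in>J. \<forall>y\<in>K.
             X (vector [t, x, y]) = vector [
               2 * f1 y * t - 1 / 2 * deriv f1 y * x\<^sup>2 - deriv f2 y * x + f3 y,
               f1 y * x + f2 y,
               c1])))"
proof -
  note M = \<open>M = coord_box I J K\<close>
  interpret coord_box_domain I J K
    by unfold_locales
      (use assms in \<open>simp_all add: open_coord_box convex_coord_box is_interval_convex\<close>)
  have X: "smooth_on (coord_box I J K) X"
    using assms by simp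
  have "\<epsilon> \<noteq> 0"
    using assms(1) by auto
  have "coord_box I J K \<noteq> {}"
    using nonempty ball_coord_box[of I J K "\<lambda>_. False"] by blast
  note homothetic = homothetic_equation_cw[OF assms(1) X this]
  have "killing_field M (cw_metric \<epsilon>) X \<longleftrightarrow>
       (\<exists>c1 c2 c3 c4. \<forall>t\<in>I. \<forall>x\<in>J. \<forall>y\<in>K.
          X (vector [t, x, y]) = vector [cw_S \<epsilon> c1 c2 y * x + c3, cw_T \<epsilon> c1 c2 y, c4])"
    \<comment> \<open>A Killing field is a homothetic one with factor 0, and both terms with \<eta>
      disappear from the formula.\<close>
    using homothetic[of 0] unfolding killing_field_def M by (simp add: ball_coord_box)
  moreover have "homothetic_field M (cw_metric \<epsilon>) X \<longleftrightarrow>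
       (\<exists>c1 c2 c3 c4 \<eta>. \<forall>t\<in>I. \<forall>x\<in>J. \<forall>y\<in>K.
          X (vector [t, x, y]) = vector [
            cw_S \<epsilon> c1 c2 y * x + c3 + \<eta> * t, cw_T \<epsilon> c1 c2 y + \<eta> / 2 * x, c4])"
    unfolding homothetic_field_def M homothetic by (simp add: ball_coord_box) blast
  ultimately show ?thesis
    unfolding M affine_field_cw[OF assms(1) X] ricci_collineation_cw[OF \<open>\<epsilon> \<noteq> 0\<close> X]
      curvature_collineation_cw[OF \<open>\<epsilon> \<noteq> 0\<close> X]
    by (simp add: ball_coord_box)
qed

end
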